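(* Suppose that $\Omega_1,\Omega_2\subset\mathbb{R}^d$ are open sets, that $\Omega_1$ is connected, and that $0\neq U:C_0(\Omega_1)\to C_0(\Omega_2)$ is a bounded linear operator such that (a) $f\cdot g=0$ implies $(Uf)\cdot(Ug)=0$ for all $f,g\in C_0(\Omega_1)$; and (b) $U(\Delta f)=\Delta(Uf)$ in the sense of distributions on $\Omega_2$, for all $f\in C_c^\infty(\Omega_1)$. Then there exist an index set $I\subset\mathbb{N}$, pairwise disjoint, connected open sets $\omega_i\subset\Omega_2$ ($i\in I$), isometries $\tau_i:\mathbb{R}^d\to\mathbb{R}^d$ with $\tau_i(\omega_i)=\Omega_1$ ($i\in I$), and constants $c_i\in\mathbb{C}$ ($i\in I$), not all zero, such that for all $f\in C_0(\Omega_1)$ $$Uf(x)=\begin{cases}c_i\,f(\tau_i(x)) & \text{if } x\in\omega_i \text{ for some } i\in I,\\ 0 & \text{otherwise.}\end{cases}$$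
   Context: Functions are complex-valued. For an open set $\Omega\subset\mathbb{R}^d$, $C_c^\infty(\Omega)$ is the space of smooth functions with compact support in $\Omega$, and $C_0(\Omega)$ is the closure of $C_c^\infty(\Omega)$ with respect to the supremum norm $\|\cdot\|_\infty$; it is equipped with this norm. *)

theory Defs
  imports "HOL-Analysis.Analysis"
begin

text \<open>
  Functions on an open set \<open>\<Omega>\<close> that belong to \<open>C\<^sub>c\<^sup>\<infinity>(\<Omega>)\<close> or \<open>C\<^sub>0(\<Omega>)\<close> are represented by their
  extensions by zero to the whole space.  The extension of a member of \<open>C\<^sub>c\<^sup>\<infinity>(\<Omega>)\<close> is smooth on the
  whole space, the extension of a member of \<open>C\<^sub>0(\<Omega>)\<close> is continuous, and supremum norms and
  products are unchanged, so nothing is lost by this identification.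
\<close>

definition partial_derivative :: "'d \<Rightarrow> (real^'d \<Rightarrow> complex) \<Rightarrow> real^'d \<Rightarrow> complex" where
  "partial_derivative i f x = frechet_derivative f (at x) (axis i 1)"

primrec C_k :: "nat \<Rightarrow> (real^'d \<Rightarrow> complex) \<Rightarrow> bool" where
  "C_k 0 f \<longleftrightarrow> continuous_on UNIV f"
| "C_k (Suc k) f \<longleftrightarrow> f differentiable_on UNIV \<and> (\<forall>i. C_k k (partial_derivative i f))"

definition smooth :: "(real^'d \<Rightarrow> complex) \<Rightarrow> bool" where
  "smooth f \<longleftrightarrow> (\<forall>k. C_k k f)"

definition laplacian :: "(real^'d \<Rightarrow> complex) \<Rightarrow> real^'d \<Rightarrow> complex" where
  "laplacian f x = (\<Sum>i\<in>UNIV. partial_derivative i (partial_derivative i f) x)"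

definition Cc_infinity :: "(real^'d) set \<Rightarrow> (real^'d \<Rightarrow> complex) set" where
  "Cc_infinity \<Omega> = {f. smooth f \<and> compact (closure {x. f x \<noteq> 0}) \<and> closure {x. f x \<noteq> 0} \<subseteq> \<Omega>}"

text \<open>
  The closure is taken in the library's space of bounded continuous functions, whose norm is the
  supremum norm.
\<close>

definition C0 :: "(real^'d) set \<Rightarrow> (real^'d \<Rightarrow> complex) set" where
  "C0 \<Omega> = apply_bcontfun ` closure {F. apply_bcontfun F \<in> Cc_infinity \<Omega>}"

text \<open>Only meaningful for bounded functions; it is applied to members of \<^const>\<open>C0\<close> only.\<close>

definition sup_norm :: "(real^'d \<Rightarrow> complex) \<Rightarrow> real" where
  "sup_norm f = (SUP x. cmod (f x))"

definition bounded_linear_C0 ::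
  "(real^'d) set \<Rightarrow> (real^'d) set \<Rightarrow> ((real^'d \<Rightarrow> complex) \<Rightarrow> real^'d \<Rightarrow> complex) \<Rightarrow> bool" where
  "bounded_linear_C0 \<Omega>\<^sub>1 \<Omega>\<^sub>2 U \<longleftrightarrow>
     U \<in> C0 \<Omega>\<^sub>1 \<rightarrow> C0 \<Omega>\<^sub>2 \<and>
     (\<forall>f\<in>C0 \<Omega>\<^sub>1. \<forall>g\<in>C0 \<Omega>\<^sub>1. U (\<lambda>x. f x + g x) = (\<lambda>x. U f x + U g x)) \<and>
     (\<forall>c. \<forall>f\<in>C0 \<Omega>\<^sub>1. U (\<lambda>x. c * f x) = (\<lambda>x. c * U f x)) \<and>
     (\<exists>K. \<forall>f\<in>C0 \<Omega>\<^sub>1. sup_norm (U f) \<le> K * sup_norm f)"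

text \<open>
  The regular distribution on \<open>\<Omega>\<close> induced by a continuous function, and the Laplacian of a
  distribution, both as functionals that are to be evaluated at test functions in
  \<open>C\<^sub>c\<^sup>\<infinity>(\<Omega>)\<close> only.
\<close>

definition regular_distribution ::
  "(real^'d) set \<Rightarrow> (real^'d \<Rightarrow> complex) \<Rightarrow> (real^'d \<Rightarrow> complex) \<Rightarrow> complex" where
  "regular_distribution \<Omega> g \<phi> = (LINT x:\<Omega>|lborel. g x * \<phi> x)"

definition distribution_laplacian ::
  "((real^'d \<Rightarrow> complex) \<Rightarrow> complex) \<Rightarrow> (real^'d \<Rightarrow> complex) \<Rightarrow> complex" where
  "distribution_laplacian T \<phi> = T (laplacian \<phi>)"

lemma Cc_infinity_subset_C0: "Cc_infinity \<Omega> \<subseteq> C0 \<Omega>"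
proof
  fix f assume f: "f \<in> Cc_infinity \<Omega>"
  then have "C_k 0 f" unfolding Cc_infinity_def smooth_def by blast
  then have cont: "continuous_on UNIV f" by simp
  let ?K = "closure {x. f x \<noteq> 0}"
  have "compact ?K" using f by (simp add: Cc_infinity_def)
  then have "bounded (f ` ?K)"
    by (meson compact_continuous_image compact_imp_bounded cont continuous_on_subset subset_UNIV)
  moreover have "range f \<subseteq> insert 0 (f ` ?K)"
    using closure_subset[of "{x. f x \<noteq> 0}"] by auto
  ultimately have "f \<in> bcontfun"
    unfolding bcontfun_def using cont bounded_insert bounded_subset by blast
  then have "apply_bcontfun (Bcontfun f) = f" by (simp add: Bcontfun_inverse)
  moreover from this have "Bcontfun f \<in> closure {F. apply_bcontfun F \<in> Cc_infinity \<Omega>}"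
    using f by (intro subsetD[OF closure_subset]) simp
  ultimately show "f \<in> C0 \<Omega>"
    unfolding C0_def by (intro image_eqI[where x = "Bcontfun f"]) simp_all
qed

lemma C_k_sum:
  assumes "finite A" "\<And>a. a \<in> A \<Longrightarrow> C_k k (f a)"
  shows "C_k k (\<lambda>x. \<Sum>a\<in>A. f a x)"
  using assms(2)
proof (induction k arbitrary: f)
  case 0
  then show ?case by (auto intro: continuous_intros)
next
  case (Suc k)
  have diff: "f a differentiable at x" if "a \<in> A" for a x
    using Suc.prems[OF that] by (simp add: differentiable_on_def)
  have "partial_derivative i (\<lambda>x. \<Sum>a\<in>A. f a x) = (\<lambda>x. \<Sum>a\<in>A. partial_derivative i (f a) x)" for i
  proof
    fix x
    have "((\<lambda>x. \<Sum>a\<in>A. f a x) has_derivative (\<lambda>h. \<Sum>a\<in>A. frechet_derivative (f a) (at x) h)) (at x)"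
      by (intro has_derivative_sum) (use diff frechet_derivative_works in blast)
    from frechet_derivative_at[OF this, symmetric]
    show "partial_derivative i (\<lambda>x. \<Sum>a\<in>A. f a x) x = (\<Sum>a\<in>A. partial_derivative i (f a) x)"
      by (simp add: partial_derivative_def)
  qed
  moreover have "(\<lambda>x. \<Sum>a\<in>A. f a x) differentiable_on UNIV"
    using diff assms(1) by (auto simp: differentiable_on_def intro!: differentiable_sum)
  moreover have "C_k k (\<lambda>x. \<Sum>a\<in>A. partial_derivative i (f a) x)" for i
    by (rule Suc.IH) (use Suc.prems in auto)
  ultimately show ?case by simp
qed

lemma smooth_laplacian:
  assumes "smooth f" shows "smooth (laplacian f)"
proof -
  have "C_k k (partial_derivative i (partial_derivative i f))" for k i
  proof -
    have "C_k (Suc (Suc k)) f" using assms unfolding smooth_def by blast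
    then show ?thesis by simp
  qed
  then have "C_k k (\<lambda>x. \<Sum>i\<in>UNIV. partial_derivative i (partial_derivative i f) x)" for k
    by (intro C_k_sum) simp_all
  moreover have "laplacian f = (\<lambda>x. \<Sum>i\<in>UNIV. partial_derivative i (partial_derivative i f) x)"
    by (simp add: fun_eq_iff laplacian_def)
  ultimately show ?thesis by (simp add: smooth_def)
qed

lemma partial_derivative_outside_support:
  assumes "x \<notin> closure {x. f x \<noteq> 0}" shows "partial_derivative i f x = 0"
proof -
  define N where "N = - closure {x. f x \<noteq> 0}"
  have "open N" "x \<in> N" using assms by (auto simp only: N_def open_Compl closed_closure Compl_iff)
  moreover have "0 = f y" if "y \<in> N" for y
    using that subsetD[OF closure_subset, of y "{x. f x \<noteq> 0}"] unfolding N_def by force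
  moreover have "((\<lambda>_. 0 :: complex) has_derivative (\<lambda>h. 0)) (at x)" by simp
  ultimately have "(f has_derivative (\<lambda>h. 0)) (at x)"
    by (metis has_derivative_transform_within_open)
  from frechet_derivative_at[OF this, symmetric] show ?thesis
    by (simp add: partial_derivative_def)
qed

lemma laplacian_Cc_infinity:
  assumes "f \<in> Cc_infinity \<Omega>" shows "laplacian f \<in> Cc_infinity \<Omega>"
proof -
  let ?S = "\<lambda>f :: real^'a \<Rightarrow> complex. closure {x. f x \<noteq> 0}"
  have pd: "?S (partial_derivative i g) \<subseteq> ?S g" for g i
    by (rule closure_minimal) (use partial_derivative_outside_support in blast, simp)
  have "laplacian f x = 0" if "x \<notin> ?S f" for x
  proof -
    have "partial_derivative i (partial_derivative i f) x = 0" for i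
      using partial_derivative_outside_support pd that by blast
    then show ?thesis by (simp add: laplacian_def)
  qed
  then have sub: "?S (laplacian f) \<subseteq> ?S f"
    by (intro closure_minimal) (blast, simp)
  moreover have "compact (?S (laplacian f))"
    using sub assms compact_Int_closed[of "?S f" "?S (laplacian f)"]
    by (simp add: Cc_infinity_def Int_absorb1)
  ultimately show ?thesis
    using assms smooth_laplacian by (auto simp: Cc_infinity_def)
qed

end

theory Submission
  imports Defs "HOL-Computational_Algebra.Polynomial"
begin

text \<open>
  Evaluation of \<open>U f\<close> at a point is a disjointness preserving functional on \<open>C\<^sub>0(\<Omega>\<^sub>1)\<close>, hence either zero
  or a multiple of a point evaluation: \<open>U f x = h x * f (\<tau> x)\<close> on an open set \<open>W\<close>, with \<open>h\<close> and \<open>\<tau>\<close>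
  continuous.  Applying the commutation hypothesis to functions that are, near \<open>\<tau> x\<close>, constant,
  affine or squares of affine functions shows that \<open>h\<close> and \<open>h (a \<bullet> \<tau>)\<close> are weakly harmonic and that
  \<open>\<Delta> (h (a \<bullet> \<tau> - c)\<^sup>2) = 2 \<bar>a\<bar>\<^sup>2 h\<close> weakly.  A mean value property with smooth radial weights replaces
  Weyl's lemma: harmonic functions are convolutions with a smooth kernel, so \<open>h\<close> and \<open>\<tau>\<close> are \<open>C\<^sup>1\<close>, and
  the second order expansion of the means of \<open>h (a \<bullet> \<tau> - c)\<^sup>2\<close> yields \<open>\<bar>\<nabla>(a \<bullet> \<tau>)\<bar> = \<bar>a\<bar>\<close>.  So \<open>\<tau>\<close> is
  locally a rigid motion by the inverse function theorem.  The derivative of \<open>h\<close> in direction \<open>b\<close> is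
  a radial mean of the harmonic function \<open>z \<mapsto> h z (b \<bullet> (z - x))\<close>, which vanishes at its centre \<open>x\<close>;
  thus \<open>h\<close> is locally constant.  The \<open>\<omega>\<^sub>i\<close> are the connected components of \<open>W\<close>.
\<close>

text \<open>The obstacle is regularity: the hypothesis yields weak identities only, for an
  \<open>h\<close> and a \<tau> not yet known to be differentiable. Affine test functions alone
  leave the metric free: with h = 1 every linear \<tau> passes them. Squares fix it. Formally,
  \<Delta>(h t^2) = t^2 \<Delta>h + 4 t (grad h, grad t) + 2 h t \<Delta>t + 2 h |grad t|^2, and for
  t = a \<bullet> \<tau> - a \<bullet> \<tau>(x) only the last term survives at x. The means turn
  this into an argument that uses continuity of \<open>h\<close> and one derivative of \<tau>.
  Weights are functions of |y|^2 and come with all their derivatives. If G has compact support,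
  harmonic functions have the mean value property for the weight G', because the derivative of the
  mean in its radius pairs the Laplacian with G. Differentiating the kernel produces G'', which is
  again such a weight. Once \<tau> is a rigid motion, every b \<bullet> (z - x) has the form a
  \<bullet> \<tau>(z) - c; this is why \<open>h\<close> times any affine function is weakly
  harmonic, which forces \<open>h\<close> to be locally constant.\<close>

subsection \<open>Smooth bumps\<close>

text \<open>All derivatives of exp(-1/t), extended by 0 to t \<le> 0, have this shape, so the class
  is closed under differentiation.\<close>

definition flat_exp :: "real poly \<Rightarrow> real \<Rightarrow> real" where
  "flat_exp p t = (if t > 0 then poly p (1 / t) * exp (- (1 / t)) else 0)"

lemma poly_times_exp_minus_tendsto_0:
  "((\<lambda>u::real. poly p u * exp (- u)) \<longlongrightarrow> 0) at_top"
proof -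
  have "((\<lambda>u. \<Sum>i\<le>degree p. coeff p i * (u ^ i / exp u)) \<longlongrightarrow> (\<Sum>i\<le>degree p. coeff p i * 0)) at_top"
    by (intro tendsto_intros tendsto_power_div_exp_0)
  moreover have "(\<Sum>i\<le>degree p. coeff p i * (u ^ i / exp u)) = poly p u * exp (- u)" for u
    by (simp add: poly_altdef sum_distrib_right exp_minus divide_inverse mult.assoc)
  ultimately show ?thesis by simp
qed

text \<open>This is the difference quotient at 0. Dividing by t only raises the degree of the
  polynomial in 1/t, and the exponential beats every polynomial.\<close>

lemma flat_exp_div_tendsto_0: "((\<lambda>t. flat_exp p t / t) \<longlongrightarrow> 0) (at 0)"
proof (rule filterlim_split_at)
  have "eventually (\<lambda>t. 0 = flat_exp p t / t) (at_left (0::real))"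
    unfolding eventually_at_left_field by (auto simp: flat_exp_def intro!: exI[of _ "-1"])
  then show "((\<lambda>t. flat_exp p t / t) \<longlongrightarrow> 0) (at_left 0)"
    by (rule Lim_transform_eventually[rotated]) simp
  have "((\<lambda>t. poly (pCons 0 p) (inverse t) * exp (- inverse t)) \<longlongrightarrow> 0) (at_right 0)"
    using filterlim_compose[OF poly_times_exp_minus_tendsto_0 filterlim_inverse_at_top_right] .
  moreover have "eventually (\<lambda>t. poly (pCons 0 p) (inverse t) * exp (- inverse t) = flat_exp p t / t)
      (at_right (0::real))"
    unfolding eventually_at_right_field
    by (auto simp: flat_exp_def field_simps intro!: exI[of _ 1])
  ultimately show "((\<lambda>t. flat_exp p t / t) \<longlongrightarrow> 0) (at_right 0)"
    by (rule Lim_transform_eventually)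
qed

text \<open>With u = 1/t the chain rule gives u^2 (p - p')(u) exp(-u); the polynomial
  \<open>[:0, 0, 1:]\<close> is u^2.\<close>

lemma flat_exp_has_derivative:
  "(flat_exp p has_real_derivative flat_exp ([:0, 0, 1:] * (p - pderiv p)) t) (at t)"
proof -
  consider "t > 0" | "t < 0" | "t = 0" by linarith
  then show ?thesis
  proof cases
    case 1
    have "((\<lambda>t. poly p (1 / t) * exp (- (1 / t))) has_real_derivative
        flat_exp ([:0, 0, 1:] * (p - pderiv p)) t) (at t)"
      using 1 unfolding flat_exp_def
      by (auto intro!: derivative_eq_intros DERIV_chain2[OF poly_DERIV] simp: field_simps power2_eq_square)
    then show ?thesis
      by (rule has_field_derivative_transform_within_open[where S = "{0<..}"])
         (use 1 in \<open>auto simp: flat_exp_def\<close>)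
  next
    case 2
    have "((\<lambda>t. 0) has_real_derivative 0) (at t)" by simp
    then have "(flat_exp p has_real_derivative 0) (at t)"
      by (rule has_field_derivative_transform_within_open[where S = "{..<0}"])
         (use 2 in \<open>auto simp: flat_exp_def\<close>)
    then show ?thesis using 2 by (simp add: flat_exp_def)
  next
    case 3
    then show ?thesis
      using flat_exp_div_tendsto_0[of p] by (simp add: has_field_derivative_iff flat_exp_def)
  qed
qed

text \<open>The radial means below use a weight together with its antiderivative and its derivative;
  here these are neighbouring indices.\<close>

definition derivative_sequence :: "(nat \<Rightarrow> real \<Rightarrow> real) \<Rightarrow> bool" where
  "derivative_sequence F \<longleftrightarrow> (\<forall>n t. (F n has_real_derivative F (Suc n) t) (at t))"

primrec flat_poly :: "nat \<Rightarrow> real poly" where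
  "flat_poly 0 = 1"
| "flat_poly (Suc n) = [:0, 0, 1:] * (flat_poly n - pderiv (flat_poly n))"

declare flat_poly.simps [simp del]

abbreviation flat :: "nat \<Rightarrow> real \<Rightarrow> real" where
  "flat n \<equiv> flat_exp (flat_poly n)"

lemma derivative_sequence_flat: "derivative_sequence flat"
  unfolding derivative_sequence_def flat_poly.simps using flat_exp_has_derivative by blast

lemma flat_0: "flat 0 t = (if t > 0 then exp (- (1 / t)) else 0)"
  by (simp add: flat_exp_def flat_poly.simps)

lemma flat_0_mono: "s \<le> t \<Longrightarrow> flat 0 s \<le> flat 0 t"
  by (auto simp: flat_0 frac_le)

lemma derivative_sequence_deriv:
  "derivative_sequence F \<Longrightarrow> (F n has_real_derivative F (Suc n) t) (at t)"
  by (simp add: derivative_sequence_def)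

lemma derivative_sequence_shift: "derivative_sequence F \<Longrightarrow> derivative_sequence (\<lambda>n. F (Suc n))"
  by (simp add: derivative_sequence_def)

lemma derivative_sequence_isCont: "derivative_sequence F \<Longrightarrow> isCont (F n) t"
  using DERIV_isCont derivative_sequence_deriv by blast

lemma derivative_sequence_continuous_on:
  assumes "derivative_sequence F" "continuous_on S q"
  shows "continuous_on S (\<lambda>x. F n (q x))"
proof -
  have "continuous_on UNIV (F n)"
    using derivative_sequence_isCont[OF assms(1)] by (simp add: continuous_on_eq_continuous_at)
  then show ?thesis using continuous_on_compose2[OF _ assms(2)] by blast
qed

text \<open>The sign comes from the inner derivative of 1 - t. At t = |y|^2, \<open>bump 0\<close>
  is the standard mollifier profile on the unit ball.\<close>

definition bump :: "nat \<Rightarrow> real \<Rightarrow> real" where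
  "bump n t = (- 1) ^ n * flat n (1 - t)"

lemma derivative_sequence_bump: "derivative_sequence bump"
  unfolding derivative_sequence_def bump_def
proof (intro allI)
  fix n :: nat and t :: real
  show "((\<lambda>t. (- 1) ^ n * flat n (1 - t)) has_real_derivative (- 1) ^ Suc n * flat (Suc n) (1 - t)) (at t)"
    by (rule DERIV_cong[OF DERIV_cmult[OF DERIV_chain2[OF
            derivative_sequence_deriv[OF derivative_sequence_flat]]]])
       (auto intro!: derivative_eq_intros)
qed

lemma bump_eq_0: "t \<ge> 1 \<Longrightarrow> bump n t = 0"
  by (simp add: bump_def flat_exp_def)

lemma bump_1_neg: "t < 1 \<Longrightarrow> bump 1 t < 0"
  by (simp add: bump_def flat_exp_def flat_poly.simps)

lemma bump_1_nonpos: "bump 1 t \<le> 0"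
  using bump_1_neg[of t] bump_eq_0[of t 1] by linarith

lemma bump_0_pos: "t < 1 \<Longrightarrow> bump 0 t > 0"
  by (simp add: bump_def flat_0)

subsection \<open>Calculus of smooth functions\<close>

lemma partial_derivative_eqI:
  "(f has_derivative f') (at x) \<Longrightarrow> partial_derivative i f x = f' (axis i 1)"
  using frechet_derivative_at by (fastforce simp: partial_derivative_def)

lemma C_k_Suc_imp: "C_k (Suc k) f \<Longrightarrow> C_k k f"
proof (induction k arbitrary: f)
  case 0
  then show ?case using differentiable_imp_continuous_on by auto
next
  case (Suc k)
  then show ?case by (metis C_k.simps(2))
qed

lemma C_k_Suc_D:
  assumes "C_k (Suc k) f"
  shows "f differentiable at x" "C_k k (partial_derivative i f)"
  using assms by (auto simp: differentiable_on_def)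

lemma C_k_Suc_I:
  assumes "\<And>x. (f has_derivative f' x) (at x)" "\<And>i. C_k k (\<lambda>x. f' x (axis i 1))"
  shows "C_k (Suc k) f"
proof -
  have "partial_derivative i f = (\<lambda>x. f' x (axis i 1))" for i
    using partial_derivative_eqI[OF assms(1)] by blast
  then show ?thesis
    using assms by (auto simp: differentiable_on_def differentiable_def)
qed

lemma C_k_const: "C_k k (\<lambda>x. c)"
proof (induction k arbitrary: c)
  case (Suc k)
  show ?case by (rule C_k_Suc_I[where f' = "\<lambda>x h. 0"]) (use Suc in auto)
qed simp

lemma C_k_add:
  assumes "C_k k f" "C_k k g" shows "C_k k (\<lambda>x. f x + g x)"
  using C_k_sum[of "UNIV :: bool set" k "\<lambda>b. if b then f else g"] assms
  by (simp add: UNIV_bool add.commute)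

lemma has_derivative_partial:
  "f differentiable at x \<Longrightarrow> (f has_derivative frechet_derivative f (at x)) (at x)"
  by (simp add: frechet_derivative_works)

lemma C_k_mult:
  assumes "C_k k f" "C_k k g" shows "C_k k (\<lambda>x. f x * g x)"
  using assms
proof (induction k arbitrary: f g)
  case 0
  then show ?case by (auto intro: continuous_intros)
next
  case (Suc k)
  show ?case
  proof (rule C_k_Suc_I)
    fix x
    show "((\<lambda>x. f x * g x) has_derivative
        (\<lambda>h. f x * frechet_derivative g (at x) h + frechet_derivative f (at x) h * g x)) (at x)"
      using Suc.prems by (intro has_derivative_mult has_derivative_partial C_k_Suc_D)
  next
    fix i
    have "C_k k (\<lambda>x. f x * partial_derivative i g x + partial_derivative i f x * g x)"
      using Suc.prems by (intro C_k_add Suc.IH C_k_Suc_imp[of k] C_k_Suc_D)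
    then show "C_k k (\<lambda>x. f x * frechet_derivative g (at x) (axis i 1) +
        frechet_derivative f (at x) (axis i 1) * g x)"
      by (simp add: partial_derivative_def)
  qed
qed

text \<open>\<open>C_k\<close> speaks of complex-valued functions only, so the real inner function
  enters through \<open>of_real\<close>. Differentiation raises the index, so the induction keeps
  \<open>n\<close> arbitrary.\<close>

lemma C_k_compose:
  fixes q :: "real^'d \<Rightarrow> real"
  assumes F: "derivative_sequence F" and "C_k k (\<lambda>x. of_real (q x))"
  shows "C_k k (\<lambda>x. of_real (F n (q x)))"
  using assms(2)
proof (induction k arbitrary: n)
  case 0
  have "continuous_on UNIV q" using continuous_on_Re[of UNIV "\<lambda>x. of_real (q x)"] 0 by simp
  then show ?case
    by (auto intro!: continuous_intros derivative_sequence_continuous_on[OF F])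
next
  case (Suc k)
  let ?Q = "\<lambda>x. complex_of_real (q x)"
  have dQ: "(?Q has_derivative frechet_derivative ?Q (at x)) (at x)" for x
    using Suc.prems by (intro has_derivative_partial C_k_Suc_D)
  have dq: "(q has_derivative (\<lambda>h. Re (frechet_derivative ?Q (at x) h))) (at x)" for x
    using has_derivative_Re[OF dQ] by simp
  \<comment> \<open>The derivative of an embedded real function takes real values; this lets the
    real chain rule serve the complex-valued \<open>C_k\<close>.\<close>
  have re: "of_real (Re (frechet_derivative ?Q (at x) h)) = frechet_derivative ?Q (at x) h" for x h
  proof -
    have "(?Q has_derivative (\<lambda>h. of_real (Re (frechet_derivative ?Q (at x) h)))) (at x)"
      by (intro has_derivative_of_real dq)
    then show ?thesis using has_derivative_unique[OF dQ] by metis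
  qed
  have dF: "((\<lambda>x. F n (q x)) has_derivative
      (\<lambda>h. F (Suc n) (q x) * Re (frechet_derivative ?Q (at x) h))) (at x)" for x
    using has_derivative_compose[OF dq, of "F n", OF
        derivative_sequence_deriv[OF F, of n, unfolded has_field_derivative_def]] .
  show ?case
  proof (rule C_k_Suc_I)
    fix x
    show "((\<lambda>x. complex_of_real (F n (q x))) has_derivative
        (\<lambda>h. of_real (F (Suc n) (q x)) * frechet_derivative ?Q (at x) h)) (at x)"
      using has_derivative_of_real[OF dF[of x], where 'a = complex] by (simp add: re)
  next
    fix i
    have "C_k k (\<lambda>x. of_real (F (Suc n) (q x)) * partial_derivative i ?Q x)"
      using Suc.prems by (intro C_k_mult Suc.IH C_k_Suc_imp[of k] C_k_Suc_D)
    then show "C_k k (\<lambda>x. of_real (F (Suc n) (q x)) * frechet_derivative ?Q (at x) (axis i 1))"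
      by (simp add: partial_derivative_def)
  qed
qed

lemma smooth_const: "smooth (\<lambda>x. c)"
  by (simp add: smooth_def C_k_const)

lemma smooth_add: "smooth f \<Longrightarrow> smooth g \<Longrightarrow> smooth (\<lambda>x. f x + g x)"
  by (simp add: smooth_def C_k_add)

lemma smooth_mult: "smooth f \<Longrightarrow> smooth g \<Longrightarrow> smooth (\<lambda>x. f x * g x)"
  by (simp add: smooth_def C_k_mult)

lemma smooth_compose:
  "derivative_sequence F \<Longrightarrow> smooth (\<lambda>x. of_real (q x)) \<Longrightarrow> smooth (\<lambda>x. of_real (F n (q x)))"
  by (simp add: smooth_def C_k_compose)

lemma smooth_inner: "smooth (\<lambda>x::real^'d. of_real (a \<bullet> x))"
  unfolding smooth_def
proof
  fix k
  show "C_k k (\<lambda>x::real^'d. of_real (a \<bullet> x))"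
  proof (cases k)
    case (Suc j)
    show ?thesis unfolding Suc
      by (rule C_k_Suc_I[where f' = "\<lambda>x h. of_real (a \<bullet> h)"])
         (auto intro!: derivative_eq_intros C_k_const)
  qed (auto intro!: continuous_intros)
qed

lemma smooth_diff: "smooth f \<Longrightarrow> smooth g \<Longrightarrow> smooth (\<lambda>x. f x - g x)"
  using smooth_add[OF _ smooth_mult[OF smooth_const[of "-1"]], of f g] by simp

lemma smooth_inner_diff: "smooth (\<lambda>x::real^'d. of_real (a \<bullet> (x - y)))"
  using smooth_diff[OF smooth_inner[of a] smooth_const[of "of_real (a \<bullet> y)"]]
  by (simp add: inner_diff_right)

lemma smooth_norm_sq: "smooth (\<lambda>x::real^'d. of_real (c * (norm (x - y))\<^sup>2))"
proof -
  have "C_k k (\<lambda>x::real^'d. \<Sum>i\<in>UNIV. of_real (axis i 1 \<bullet> (x - y)) * of_real (axis i 1 \<bullet> (x - y)))" for k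
    by (intro C_k_sum C_k_mult smooth_inner_diff[unfolded smooth_def, rule_format]) simp
  then have "smooth (\<lambda>x::real^'d. of_real c * (\<Sum>i\<in>UNIV. of_real (axis i 1 \<bullet> (x - y)) * of_real (axis i 1 \<bullet> (x - y))))"
    by (intro smooth_mult smooth_const) (simp add: smooth_def)
  moreover have "(\<Sum>i\<in>UNIV. of_real (axis i 1 \<bullet> (x - y)) * of_real (axis i 1 \<bullet> (x - y))) = complex_of_real ((norm (x - y))\<^sup>2)"
    for x y :: "real^'d"
    by (simp add: power2_norm_eq_inner inner_vec_def[of "x-y"] inner_axis' of_real_sum)
  ultimately show ?thesis by simp
qed

lemma Cc_infinityI:
  fixes f :: "real^'d \<Rightarrow> complex"
  assumes "smooth f" "compact K" "K \<subseteq> \<Omega>" "\<And>x. x \<notin> K \<Longrightarrow> f x = 0"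
  shows "f \<in> Cc_infinity \<Omega>"
proof -
  have "closure {x. f x \<noteq> 0} \<subseteq> K"
    using assms(2,4) by (intro closure_minimal compact_imp_closed) auto
  then show ?thesis
    using assms compact_Int_closed[of K "closure {x. f x \<noteq> 0}"]
    by (auto simp: Cc_infinity_def Int_absorb1)
qed

lemma Cc_infinityE:
  fixes f :: "real^'d \<Rightarrow> complex"
  assumes "f \<in> Cc_infinity \<Omega>"
  obtains K where "smooth f" "compact K" "K \<subseteq> \<Omega>" "\<And>x. x \<notin> K \<Longrightarrow> f x = 0"
  using assms closure_subset[of "{x. f x \<noteq> 0}"] unfolding Cc_infinity_def by blast

lemma Cc_infinity_mult_smooth:
  assumes "f \<in> Cc_infinity \<Omega>" "smooth g" shows "(\<lambda>x. f x * g x) \<in> Cc_infinity \<Omega>"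
  using assms(1)
proof (rule Cc_infinityE)
  fix K assume "smooth f" "compact K" "K \<subseteq> \<Omega>" "\<And>x. x \<notin> K \<Longrightarrow> f x = 0"
  then show ?thesis by (intro Cc_infinityI[of _ K] smooth_mult assms(2)) auto
qed

lemma Cc_infinity_mono: "A \<subseteq> B \<Longrightarrow> Cc_infinity A \<subseteq> Cc_infinity B"
  by (auto simp: Cc_infinity_def)

text \<open>
  With \<open>c = flat 0 (\<rho>\<^sup>2 / 2)\<close>, the profile \<open>u \<mapsto> 1 - flat 0 (c - u) / flat 0 c\<close> rises from 0 at \<open>u = 0\<close>
  to the constant 1 for \<open>u \<ge> c\<close>; applied to \<open>u = flat 0 (\<rho>\<^sup>2 - \<bar>x - y\<bar>\<^sup>2)\<close> it gives the cutoff.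
\<close>

lemma cutoff_exists:
  fixes y :: "real^'d"
  assumes "\<rho> > 0"
  obtains \<eta> \<delta> where "smooth \<eta>" "0 < \<delta>" "\<And>x. norm (\<eta> x) \<le> 1" "\<And>x. norm (1 - \<eta> x) \<le> 1"
    "\<And>x. x \<in> ball y \<delta> \<Longrightarrow> \<eta> x = (1::complex)" "\<And>x. x \<notin> cball y \<rho> \<Longrightarrow> \<eta> x = 0"
proof -
  define c where "c = flat 0 (\<rho>\<^sup>2 / 2)"
  define q where "q x = flat 0 (\<rho>\<^sup>2 - (norm (x - y))\<^sup>2)" for x
  define s where "s x = flat 0 (c - q x) / flat 0 c" for x
  have c: "c > 0" using assms by (simp add: c_def flat_0)
  then have c': "flat 0 c > 0" by (simp add: flat_0)
  have nonneg: "flat 0 t \<ge> 0" for t by (simp add: flat_0)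
  have s: "0 \<le> s x" "s x \<le> 1" for x
    using c' nonneg[of "c - q x"] flat_0_mono[of "c - q x" c] nonneg
    by (auto simp: s_def q_def divide_simps)
  define \<eta> where "\<eta> x = complex_of_real (1 - s x)" for x
  show thesis
  proof
    have "smooth (\<lambda>x. of_real (\<rho>\<^sup>2 - (norm (x - y))\<^sup>2))"
      using smooth_diff[OF smooth_const[of "of_real (\<rho>\<^sup>2)"] smooth_norm_sq[of 1 y]] by simp
    then have "smooth (\<lambda>x. of_real (q x))"
      unfolding q_def by (rule smooth_compose[OF derivative_sequence_flat])
    then have "smooth (\<lambda>x. of_real (c - q x))"
      using smooth_diff[OF smooth_const[of "of_real c"], of "\<lambda>x. of_real (q x)"] by simp
    then have "smooth (\<lambda>x. of_real (flat 0 (c - q x)))"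
      by (rule smooth_compose[OF derivative_sequence_flat])
    then have "smooth (\<lambda>x. 1 - of_real (flat 0 (c - q x)) * of_real (1 / flat 0 c))"
      by (intro smooth_diff smooth_const smooth_mult)
    then show "smooth \<eta>" by (simp add: \<eta>_def[abs_def] s_def)
    show "norm (\<eta> x) \<le> 1" "norm (1 - \<eta> x) \<le> 1" for x
      using s[of x] norm_of_real[of "1 - s x", where 'a = complex] by (simp_all add: \<eta>_def)
    \<comment> \<open>Every radius up to \<rho> / sqrt 2 would do: there \<rho>^2 - |x - y|^2 \<ge>
      \<rho>^2 / 2, so \<open>q x\<close> is at least \<open>c\<close>.\<close>
    show "\<rho> / 2 > 0" using assms by simp
    show "\<eta> x = 1" if "x \<in> ball y (\<rho> / 2)" for x
    proof -
      have "norm (x - y) < \<rho> / 2" using that by (simp add: dist_norm norm_minus_commute)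
      then have "(norm (x - y))\<^sup>2 \<le> (\<rho> / 2)\<^sup>2" by (intro power_mono) auto
      also have "\<dots> \<le> \<rho>\<^sup>2 / 2" by (simp add: power_divide)
      finally have "c \<le> q x" unfolding c_def q_def by (intro flat_0_mono) simp
      then show ?thesis by (simp add: \<eta>_def s_def flat_0)
    qed
    show "\<eta> x = 0" if "x \<notin> cball y \<rho>" for x
    proof -
      have "norm (x - y) > \<rho>" using that by (simp add: dist_norm norm_minus_commute)
      then have "(norm (x - y))\<^sup>2 > \<rho>\<^sup>2" using assms by (intro power_strict_mono) auto
      then have "q x = 0" by (simp add: q_def flat_0)
      then show ?thesis using c' by (simp add: \<eta>_def s_def)
    qed
  qed
qed

subsection \<open>Disjointness preserving functionals\<close>

lemma C0D_bcontfun: "f \<in> C0 \<Omega> \<Longrightarrow> f \<in> bcontfun"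
  by (auto simp: C0_def apply_bcontfun)

lemma C0_continuous_on: "f \<in> C0 \<Omega> \<Longrightarrow> continuous_on S f"
  using C0D_bcontfun[of f \<Omega>] continuous_on_subset[of UNIV f S] by (simp add: bcontfun_def)

lemma C0_approx:
  assumes "f \<in> C0 \<Omega>" "e > 0"
  obtains g where "g \<in> Cc_infinity \<Omega>" "\<And>x. norm (f x - g x) \<le> e"
proof -
  obtain F where F: "f = apply_bcontfun F" "F \<in> closure {F. apply_bcontfun F \<in> Cc_infinity \<Omega>}"
    using assms(1) by (auto simp: C0_def)
  then obtain G where G: "apply_bcontfun G \<in> Cc_infinity \<Omega>" "dist G F < e"
    using assms(2) by (auto simp: closure_approachable)
  have "norm (f x - apply_bcontfun G x) \<le> e" for x
    using dist_bounded[of F x G] G(2) F(1) unfolding dist_norm[symmetric] dist_commute[of G] by simp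
  then show thesis using that G(1) by blast
qed

text \<open>With \<open>C0_approx\<close> this characterises \<open>C0\<close> by uniform
  approximation, so that later arguments avoid the type of bounded continuous functions.\<close>

lemma C0I:
  assumes cont: "continuous_on UNIV f"
    and approx: "\<And>e. e > 0 \<Longrightarrow> \<exists>g\<in>Cc_infinity \<Omega>. \<forall>x. norm (f x - g x) \<le> e"
  shows "f \<in> C0 \<Omega>"
proof -
  \<comment> \<open>Being within distance 1 of a bounded function shows that \<open>f\<close> is
    bounded, as \<open>Bcontfun_inverse\<close> requires.\<close>
  obtain g where g: "g \<in> Cc_infinity \<Omega>" "\<And>x. norm (f x - g x) \<le> 1"
    using approx[of 1] by auto
  then have "g \<in> bcontfun" using Cc_infinity_subset_C0 C0D_bcontfun by blast
  then obtain B where "\<And>x. norm (g x) \<le> B" by (auto simp: bcontfun_def bounded_iff)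
  then have "norm (f x) \<le> B + 1" for x
    using g(2)[of x] norm_triangle_sub[of "f x" "g x"] by (smt (verit))
  then have f: "f \<in> bcontfun" using cont by (auto simp: bcontfun_def bounded_iff)
  have "Bcontfun f \<in> closure {F. apply_bcontfun F \<in> Cc_infinity \<Omega>}"
    unfolding closure_approachable
  proof (intro allI impI)
    fix e :: real assume "e > 0"
    then obtain g where g: "g \<in> Cc_infinity \<Omega>" "\<And>x. norm (f x - g x) \<le> e / 2"
      using approx[of "e / 2"] by auto
    have "g \<in> bcontfun" using g(1) Cc_infinity_subset_C0 C0D_bcontfun by blast
    then have "dist (Bcontfun g) (Bcontfun f) \<le> e / 2"
      using g(2) f by (intro dist_bound) (simp add: Bcontfun_inverse dist_norm norm_minus_commute)
    then show "\<exists>F\<in>{F. apply_bcontfun F \<in> Cc_infinity \<Omega>}. dist F (Bcontfun f) < e"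
      using g(1) \<open>g \<in> bcontfun\<close> \<open>e > 0\<close>
      by (intro bexI[of _ "Bcontfun g"]) (auto simp: Bcontfun_inverse)
  qed
  then show ?thesis
    unfolding C0_def using Bcontfun_inverse[OF f] by (intro image_eqI[of _ _ "Bcontfun f"]) auto
qed

lemma Cc_infinity_add:
  assumes "f \<in> Cc_infinity \<Omega>" "g \<in> Cc_infinity \<Omega>"
  shows "(\<lambda>x. f x + g x) \<in> Cc_infinity \<Omega>"
proof -
  obtain K where "smooth f" "compact K" "K \<subseteq> \<Omega>" "\<And>x. x \<notin> K \<Longrightarrow> f x = 0"
    using Cc_infinityE[OF assms(1)] by blast
  moreover obtain K' where "smooth g" "compact K'" "K' \<subseteq> \<Omega>" "\<And>x. x \<notin> K' \<Longrightarrow> g x = 0"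
    using Cc_infinityE[OF assms(2)] by blast
  ultimately show ?thesis by (intro Cc_infinityI[of _ "K \<union> K'"] smooth_add) auto
qed

lemma C0_add:
  assumes "f \<in> C0 \<Omega>" "g \<in> C0 \<Omega>" shows "(\<lambda>x. f x + g x) \<in> C0 \<Omega>"
proof (rule C0I)
  show "continuous_on UNIV (\<lambda>x. f x + g x)"
    using assms by (intro continuous_intros C0_continuous_on)
  fix e :: real assume "e > 0"
  then obtain u v where uv: "u \<in> Cc_infinity \<Omega>" "\<And>x. norm (f x - u x) \<le> e / 2"
      "v \<in> Cc_infinity \<Omega>" "\<And>x. norm (g x - v x) \<le> e / 2"
    using C0_approx[OF assms(1), of "e / 2"] C0_approx[OF assms(2), of "e / 2"] by (metis half_gt_zero)
  have "norm (f x + g x - (u x + v x)) \<le> e" for x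
    using norm_diff_triangle_ineq[of "f x" "g x" "u x" "v x"] uv(2)[of x] uv(4)[of x] by linarith
  then show "\<exists>h\<in>Cc_infinity \<Omega>. \<forall>x. norm (f x + g x - h x) \<le> e"
    by (intro bexI[OF _ Cc_infinity_add[OF uv(1,3)]]) blast
qed

lemma C0_cmult:
  assumes "f \<in> C0 \<Omega>" shows "(\<lambda>x. c * f x) \<in> C0 \<Omega>"
proof (rule C0I)
  show "continuous_on UNIV (\<lambda>x. c * f x)"
    using assms by (intro continuous_intros C0_continuous_on)
  fix e :: real assume "e > 0"
  then have "e / (norm c + 1) > 0" by (smt (verit) divide_pos_pos norm_ge_zero)
  then obtain u where u: "u \<in> Cc_infinity \<Omega>" "\<And>x. norm (f x - u x) \<le> e / (norm c + 1)"
    using C0_approx[OF assms] by metis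
  have "norm (c * f x - c * u x) \<le> e" for x
  proof -
    have "norm (c * f x - c * u x) \<le> norm c * (e / (norm c + 1))"
      using u(2)[of x] by (simp add: mult_left_mono flip: right_diff_distrib norm_mult)
        (metis mult_left_mono norm_ge_zero norm_mult times_divide_eq_right)
    also have "\<dots> \<le> e" using \<open>e > 0\<close> by (simp add: field_simps add_pos_nonneg)
    finally show ?thesis .
  qed
  moreover have "(\<lambda>x. c * u x) \<in> Cc_infinity \<Omega>"
    using Cc_infinity_mult_smooth[OF u(1) smooth_const[of c]] by (simp add: mult.commute)
  ultimately show "\<exists>h\<in>Cc_infinity \<Omega>. \<forall>x. norm (c * f x - h x) \<le> e"
    by (intro bexI[where x = "\<lambda>x. c * u x"]) auto
qed

lemma C0_diff:
  assumes "f \<in> C0 \<Omega>" "g \<in> C0 \<Omega>" shows "(\<lambda>x. f x - g x) \<in> C0 \<Omega>"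
  using C0_add[OF assms(1) C0_cmult[OF assms(2), of "- 1"]] by simp

lemma C0_eq_0:
  assumes "f \<in> C0 \<Omega>" "x \<notin> \<Omega>" shows "f x = 0"
proof -
  have "norm (f x) \<le> 0 + e" if "e > 0" for e
  proof -
    obtain g where g: "g \<in> Cc_infinity \<Omega>" "\<And>x. norm (f x - g x) \<le> e"
      using C0_approx[OF assms(1) \<open>e > 0\<close>] by metis
    have "g x = 0" using g(1) assms(2) by (auto elim!: Cc_infinityE)
    then show ?thesis using g(2)[of x] by simp
  qed
  then have "norm (f x) \<le> 0" by (rule field_le_epsilon)
  then show ?thesis by simp
qed

lemma Cc_infinity_C0: "f \<in> Cc_infinity \<Omega> \<Longrightarrow> f \<in> C0 \<Omega>"
  using Cc_infinity_subset_C0 by blast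

lemma smooth_prod: "(\<And>a. a \<in> A \<Longrightarrow> smooth (f a)) \<Longrightarrow> smooth (\<lambda>x. \<Prod>a\<in>A. f a x)"
  by (induction A rule: infinite_finite_induct) (auto intro: smooth_const smooth_mult)

text \<open>
  The functional is supported at a single point: it cannot have two support points because of
  disjointness, and a function vanishing near the support is annihilated because multiplying it by
  suitable factors \<open>1 - \<eta>\<close> does not change its value under \<open>L\<close> but eventually makes it zero.
\<close>

proposition disjointness_preserving_functional:
  fixes L :: "(real^'d \<Rightarrow> complex) \<Rightarrow> complex"
  assumes "open \<Omega>"
    and add: "\<And>f g. f \<in> C0 \<Omega> \<Longrightarrow> g \<in> C0 \<Omega> \<Longrightarrow> L (\<lambda>x. f x + g x) = L f + L g"
    and scale: "\<And>c f. f \<in> C0 \<Omega> \<Longrightarrow> L (\<lambda>x. c * f x) = c * L f"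
    and bound: "\<And>f B. f \<in> C0 \<Omega> \<Longrightarrow> (\<And>x. norm (f x) \<le> B) \<Longrightarrow> norm (L f) \<le> M * B"
    and disj: "\<And>f g. f \<in> C0 \<Omega> \<Longrightarrow> g \<in> C0 \<Omega> \<Longrightarrow> \<forall>x. f x * g x = 0 \<Longrightarrow> L f * L g = 0"
    and nz: "\<exists>f\<in>C0 \<Omega>. L f \<noteq> 0"
  obtains y c where "y \<in> \<Omega>" "c \<noteq> 0" "\<And>f. f \<in> C0 \<Omega> \<Longrightarrow> L f = c * f y"
proof -
  have diff: "L (\<lambda>x. f x - g x) = L f - L g" if "f \<in> C0 \<Omega>" "g \<in> C0 \<Omega>" for f g
    using add[OF that(1) C0_cmult[OF that(2), of "- 1"]] scale[OF that(2), of "- 1"] by simp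
  define S where "S y \<longleftrightarrow> (\<forall>\<delta>>0. \<exists>f\<in>C0 \<Omega>. (\<forall>x. x \<notin> ball y \<delta> \<longrightarrow> f x = 0) \<and> L f \<noteq> 0)" for y

  have vanish: "L f = 0"
    if f: "f \<in> Cc_infinity \<Omega>" and K: "compact K" "\<And>x. x \<notin> K \<Longrightarrow> f x = 0" "\<And>y. y \<in> K \<Longrightarrow> \<not> S y" for f K
  proof -
    \<comment> \<open>Since \<open>L\<close> kills every \<open>g * \<eta>\<close>, multiplying a
      test function by \<open>1 - \<eta>\<close> leaves its value under \<open>L\<close>
      unchanged.\<close>
    define Q where "Q y \<eta> \<delta> \<longleftrightarrow> 0 < \<delta> \<and> smooth \<eta> \<and> (\<forall>x\<in>ball y \<delta>. \<eta> x = 1) \<and>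
        (\<forall>g\<in>Cc_infinity \<Omega>. L (\<lambda>x. g x * \<eta> x) = 0)" for y \<eta> \<delta>
    have "\<exists>\<eta> \<delta>. Q y \<eta> \<delta>" if y: "y \<in> K" for y
    proof -
      obtain r where r: "r > 0" "\<And>f. f \<in> C0 \<Omega> \<Longrightarrow> (\<And>x. x \<notin> ball y r \<Longrightarrow> f x = 0) \<Longrightarrow> L f = 0"
        using K(3)[OF y] unfolding S_def by metis
      obtain \<eta> \<delta> where \<eta>: "smooth \<eta>" "0 < \<delta>" "\<And>x. x \<in> ball y \<delta> \<Longrightarrow> \<eta> x = (1::complex)"
          "\<And>x. x \<notin> cball y (r / 2) \<Longrightarrow> \<eta> x = 0"
        using cutoff_exists[of "r / 2" y] r(1) by (metis half_gt_zero)
      have "L (\<lambda>x. g x * \<eta> x) = 0" if g: "g \<in> Cc_infinity \<Omega>" for g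
      proof (rule r(2))
        show "(\<lambda>x. g x * \<eta> x) \<in> C0 \<Omega>"
          by (intro Cc_infinity_C0 Cc_infinity_mult_smooth g \<eta>)
        show "g x * \<eta> x = 0" if "x \<notin> ball y r" for x
          using \<eta>(4)[of x] that r(1) by auto
      qed
      with \<eta> have "Q y \<eta> \<delta>" unfolding Q_def by (intro conjI ballI)
      then show ?thesis by blast
    qed
    then obtain \<eta> \<delta> where Q: "\<And>y. y \<in> K \<Longrightarrow> Q y (\<eta> y) (\<delta> y)" by metis
    have \<eta>: "\<And>y. y \<in> K \<Longrightarrow> 0 < \<delta> y" "\<And>y. y \<in> K \<Longrightarrow> smooth (\<eta> y)"
        "\<And>y x. y \<in> K \<Longrightarrow> x \<in> ball y (\<delta> y) \<Longrightarrow> \<eta> y x = 1"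
        "\<And>y g. y \<in> K \<Longrightarrow> g \<in> Cc_infinity \<Omega> \<Longrightarrow> L (\<lambda>x. g x * \<eta> y x) = 0"
      using Q unfolding Q_def by blast+
    obtain F where F: "F \<subseteq> K" "finite F" "K \<subseteq> (\<Union>y\<in>F. ball y (\<delta> y))"
    proof (rule compactE_image[OF K(1), of K "\<lambda>y. ball y (\<delta> y)"])
      show "K \<subseteq> (\<Union>c\<in>K. ball c (\<delta> c))" using \<eta>(1) by force
    qed simp_all
    have Cc: "(\<lambda>x. f x * (\<Prod>y\<in>G. 1 - \<eta> y x)) \<in> Cc_infinity \<Omega>" if "G \<subseteq> K" for G
      using that \<eta>(2)
      by (intro Cc_infinity_mult_smooth f smooth_prod smooth_diff smooth_const) auto
    have "L (\<lambda>x. f x * (\<Prod>y\<in>G. 1 - \<eta> y x)) = L f" if "finite G" "G \<subseteq> K" for G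
      using that
    proof (induction G rule: finite_induct)
      case (insert a G)
      let ?g = "\<lambda>x. f x * (\<Prod>y\<in>G. 1 - \<eta> y x)"
      have a: "a \<in> K" "?g \<in> Cc_infinity \<Omega>" using insert.prems Cc by auto
      have "(\<lambda>x. f x * (\<Prod>y\<in>insert a G. 1 - \<eta> y x)) = (\<lambda>x. ?g x - ?g x * \<eta> a x)"
        using insert.hyps by (simp add: algebra_simps)
      then have "L (\<lambda>x. f x * (\<Prod>y\<in>insert a G. 1 - \<eta> y x)) = L (\<lambda>x. ?g x - ?g x * \<eta> a x)"
        by (rule arg_cong)
      moreover have "L (\<lambda>x. ?g x - ?g x * \<eta> a x) = L ?g - L (\<lambda>x. ?g x * \<eta> a x)"
        by (rule diff[OF Cc_infinity_C0[OF a(2)] Cc_infinity_C0[OF Cc_infinity_mult_smooth[OF a(2) \<eta>(2)[OF a(1)]]]])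
      moreover have "L (\<lambda>x. ?g x * \<eta> a x) = 0" by (rule \<eta>(4)[OF a])
      moreover have "L ?g = L f" using insert.prems by (intro insert.IH) simp
      ultimately show ?case by (simp only: diff_0_right)
    qed simp
    note telescope = this[OF F(2,1)]
    have "(\<lambda>x. f x * (\<Prod>y\<in>F. 1 - \<eta> y x)) = (\<lambda>x. 0 * f x)"
    proof
      fix x show "f x * (\<Prod>y\<in>F. 1 - \<eta> y x) = 0 * f x"
      proof (cases "x \<in> K")
        case True
        then obtain y where "y \<in> F" "x \<in> ball y (\<delta> y)" using F(3) by blast
        then have "\<exists>y\<in>F. 1 - \<eta> y x = 0" using \<eta>(3)[of y x] F(1) by (intro bexI[of _ y]) auto
        from prod_zero[OF F(2) this] show ?thesis by simp
      qed (simp add: K(2))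
    qed
    with telescope scale[OF Cc_infinity_C0[OF f], of 0] show ?thesis by (metis mult_zero_left)
  qed

  \<comment> \<open>\<open>M\<close> may be negative a priori; with its absolute value the bound is
    monotone in \<open>B\<close>.\<close>
  have M: "norm (L f) \<le> \<bar>M\<bar> * B" if "f \<in> C0 \<Omega>" "\<And>x. norm (f x) \<le> B" for f B
  proof -
    have "0 \<le> B" using that(2)[of undefined] norm_ge_zero order_trans by blast
    then show ?thesis using bound[OF that] by (smt (verit) mult_right_mono)
  qed
  have eq_0: "L f = 0" if *: "\<And>e. e > 0 \<Longrightarrow> norm (L f) \<le> \<bar>M\<bar> * e" for f
  proof -
    have "norm (L f) \<le> 0 + e" if "e > 0" for e
    proof -
      have "norm (L f) \<le> \<bar>M\<bar> * (e / (\<bar>M\<bar> + 1))" using that by (intro *) simp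
      also have "\<dots> \<le> e" using that by (simp add: field_simps)
      finally show ?thesis by simp
    qed
    then have "norm (L f) \<le> 0" by (rule field_le_epsilon)
    then show ?thesis by simp
  qed

  \<comment> \<open>Without a support point in \<Omega>, \<open>vanish\<close> would apply to every
    test function, and density would make \<open>L\<close> zero.\<close>
  have "\<exists>y\<in>\<Omega>. S y"
  proof (rule ccontr)
    assume nS: "\<not> (\<exists>y\<in>\<Omega>. S y)"
    have Cc0: "L g = 0" if g: "g \<in> Cc_infinity \<Omega>" for g
      using g
    proof (rule Cc_infinityE)
      fix K assume "compact K" "K \<subseteq> \<Omega>" "\<And>x. x \<notin> K \<Longrightarrow> g x = 0"
      then show ?thesis using nS by (intro vanish[OF g, of K]) auto
    qed
    have "L f = 0" if f: "f \<in> C0 \<Omega>" for f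
    proof (rule eq_0)
      fix e :: real assume "e > 0"
      then obtain g where g: "g \<in> Cc_infinity \<Omega>" "\<And>x. norm (f x - g x) \<le> e"
        using C0_approx[OF f] by metis
      then have "norm (L (\<lambda>x. f x - g x)) \<le> \<bar>M\<bar> * e"
        by (intro M C0_diff f Cc_infinity_C0)
      then show "norm (L f) \<le> \<bar>M\<bar> * e"
        using diff[OF f Cc_infinity_C0[OF g(1)]] Cc0[OF g(1)] by simp
    qed
    then show False using nz by blast
  qed
  then obtain y where y: "y \<in> \<Omega>" "S y" by blast
  have unique: "z = y" if "S z" for z
  proof (rule ccontr)
    assume "z \<noteq> y"
    define r where "r = dist z y / 2"
    have "r > 0" using \<open>z \<noteq> y\<close> by (simp add: r_def)
    then obtain f g where fg: "f \<in> C0 \<Omega>" "\<And>x. x \<notin> ball y r \<Longrightarrow> f x = 0" "L f \<noteq> 0"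
        "g \<in> C0 \<Omega>" "\<And>x. x \<notin> ball z r \<Longrightarrow> g x = 0" "L g \<noteq> 0"
      using y(2) \<open>S z\<close> unfolding S_def by meson
    have "f x * g x = 0" for x
    proof -
      have "x \<notin> ball y r \<or> x \<notin> ball z r"
        using dist_triangle[of z y x] by (auto simp: r_def dist_commute)
      then show ?thesis using fg(2,5) by auto
    qed
    then show False using disj[OF fg(1,4)] fg(3,6) by simp
  qed
  have vanish_near: "L g = 0" if g: "g \<in> Cc_infinity \<Omega>" and "\<delta> > 0" "\<And>x. x \<in> ball y \<delta> \<Longrightarrow> g x = 0" for g \<delta>
    using g
  proof (rule Cc_infinityE)
    fix K assume "compact K" "K \<subseteq> \<Omega>" "\<And>x. x \<notin> K \<Longrightarrow> g x = 0"
    \<comment> \<open>Removing the ball around \<open>y\<close> leaves a compact set free of support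
      points, since \<open>y\<close> is the only one.\<close>
    then show ?thesis using that unique by (intro vanish[OF g, of "K - ball y \<delta>"] compact_diff) auto
  qed
  have zero: "L f = 0" if f: "f \<in> C0 \<Omega>" and "f y = 0" for f
  proof (rule eq_0)
    fix e' :: real assume "e' > 0"
    \<comment> \<open>One share is spent on \<open>f - g\<close> and two on
      \<open>g * \<eta>\<close>: near \<open>y\<close> the approximant is at most
      \<open>2 * e\<close>, being at most \<open>e\<close> at \<open>y\<close> and varying by less
      than \<open>e\<close>.\<close>
    define e where "e = e' / 3"
    have "e > 0" using \<open>e' > 0\<close> by (simp add: e_def)
    then obtain g where g: "g \<in> Cc_infinity \<Omega>" "\<And>x. norm (f x - g x) \<le> e"
      using C0_approx[OF f] by metis
    have gy: "norm (g y) \<le> e" using g(2)[of y] \<open>f y = 0\<close> by simp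
    have "continuous_on UNIV g"
      using C0_continuous_on[OF Cc_infinity_C0[OF g(1)]] .
    then obtain d where d: "d > 0" "\<And>x. dist x y < d \<Longrightarrow> dist (g x) (g y) < e"
      using \<open>e > 0\<close> unfolding continuous_on_iff by blast
    have g2: "norm (g x) \<le> 2 * e" if "dist x y < d" for x
      using d(2)[OF that] gy norm_triangle_sub[of "g x" "g y"] by (simp add: dist_norm)
    obtain \<eta> \<delta> where \<eta>: "smooth \<eta>" "0 < \<delta>" "\<And>x. norm (\<eta> x) \<le> 1"
        "\<And>x. x \<in> ball y \<delta> \<Longrightarrow> \<eta> x = (1::complex)" "\<And>x. x \<notin> cball y (d / 2) \<Longrightarrow> \<eta> x = 0"
      using cutoff_exists[of "d / 2" y] d(1) by (metis half_gt_zero)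
    let ?g = "\<lambda>x. g x * \<eta> x" and ?h = "\<lambda>x. g x * (1 - \<eta> x)"
    have Cc: "?g \<in> Cc_infinity \<Omega>" "?h \<in> Cc_infinity \<Omega>"
      by (intro Cc_infinity_mult_smooth g smooth_diff smooth_const \<eta>)+
    have "L g = L (\<lambda>x. ?g x + ?h x)" by (simp add: algebra_simps)
    also have "\<dots> = L ?g + L ?h" by (intro add Cc_infinity_C0 Cc)
    also have "L ?h = 0" using \<eta> by (intro vanish_near[OF Cc(2), of \<delta>]) auto
    finally have "L g = L ?g" by simp
    moreover have "norm (g x * \<eta> x) \<le> 2 * e" for x
    proof (cases "x \<in> cball y (d / 2)")
      case True
      then have "norm (g x) \<le> 2 * e" using d(1) by (intro g2) (auto simp: dist_commute)
      then show ?thesis using mult_mono[OF _ \<eta>(3)[of x], of "norm (g x)" "2 * e"] \<open>e > 0\<close>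
        by (simp add: norm_mult)
    qed (use \<eta>(5) \<open>e > 0\<close> in simp)
    ultimately have "norm (L g) \<le> \<bar>M\<bar> * (2 * e)" using M[OF Cc_infinity_C0[OF Cc(1)]] by simp
    moreover have "norm (L f - L g) \<le> \<bar>M\<bar> * e"
      unfolding diff[OF f Cc_infinity_C0[OF g(1)], symmetric]
      using g by (intro M C0_diff f Cc_infinity_C0)
    ultimately have "norm (L f) \<le> \<bar>M\<bar> * (2 * e) + \<bar>M\<bar> * e"
      using norm_triangle_sub[of "L f" "L g"] by linarith
    then show "norm (L f) \<le> \<bar>M\<bar> * e'" by (simp add: e_def mult.commute)
  qed
  obtain \<rho> where \<rho>: "\<rho> > 0" "cball y \<rho> \<subseteq> \<Omega>" using \<open>open \<Omega>\<close> y(1) open_contains_cball by blast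
  obtain \<eta> \<delta> where \<eta>: "smooth \<eta>" "0 < \<delta>" "\<And>x. x \<in> ball y \<delta> \<Longrightarrow> \<eta> x = (1::complex)"
      "\<And>x. x \<notin> cball y \<rho> \<Longrightarrow> \<eta> x = 0"
    using cutoff_exists[OF \<rho>(1), of y] by metis
  have \<eta>C: "\<eta> \<in> C0 \<Omega>" using \<eta> \<rho> by (intro Cc_infinity_C0 Cc_infinityI[of _ "cball y \<rho>"]) auto
  \<comment> \<open>Subtracting \<open>f y * \<eta>\<close> makes the function vanish at
    \<open>y\<close>, so the constant is \<open>L \<eta>\<close>.\<close>
  have rep: "L f = L \<eta> * f y" if f: "f \<in> C0 \<Omega>" for f
  proof -
    have "L (\<lambda>x. f x - f y * \<eta> x) = 0"
      using \<eta>(2,3) by (intro zero C0_diff C0_cmult f \<eta>C) simp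
    then show ?thesis
      unfolding diff[OF f C0_cmult[OF \<eta>C]] scale[OF \<eta>C] by (simp add: mult.commute)
  qed
  show thesis
  proof (rule that[OF y(1) _ rep])
    obtain f where f: "f \<in> C0 \<Omega>" "L f \<noteq> 0" using nz by blast
    from rep[OF f(1)] f(2) show "L \<eta> \<noteq> 0" by (metis mult_zero_left)
  qed
qed

subsection \<open>Radial mean values\<close>

text \<open>Continuity in a parameter and Leibniz's rule are applied to gauge integrals over boxes,
  while distributions are Lebesgue integrals; this is the passage between the two.\<close>

lemma lborel_integral_eq_cbox:
  fixes F :: "'a::euclidean_space \<Rightarrow> 'b::euclidean_space"
  assumes "continuous_on UNIV F" "\<And>x. x \<notin> cbox a b \<Longrightarrow> F x = 0"
  shows "integrable lborel F" "integral\<^sup>L lborel F = integral (cbox a b) F"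
proof -
  have eq: "(\<lambda>x. indicator (cbox a b) x *\<^sub>R F x) = F"
    using assms(2) by (auto simp: indicator_def)
  have "integrable lborel (\<lambda>x. indicator (cbox a b) x *\<^sub>R F x)"
    using assms(1) by (intro borel_integrable_compact compact_cbox) (rule continuous_on_subset, auto)
  then have "set_integrable lborel (cbox a b) F" by (simp add: set_integrable_def)
  from set_borel_integral_eq_integral(2)[OF this]
  show "integral\<^sup>L lborel F = integral (cbox a b) F" by (simp add: set_lebesgue_integral_def eq)
  from \<open>integrable lborel (\<lambda>x. indicator (cbox a b) x *\<^sub>R F x)\<close> show "integrable lborel F"
    by (simp only: eq)
qed

lemma lborel_integrable_bounded_support:
  fixes F :: "'a::euclidean_space \<Rightarrow> 'b::euclidean_space"
  assumes "continuous_on UNIV F" "\<And>x. norm x \<ge> R \<Longrightarrow> F x = 0"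
  shows "integrable lborel F"
proof -
  obtain a where a: "cball (0::'a) R \<subseteq> cbox (- a) a"
    using bounded_subset_cbox_symmetric[OF bounded_cball] by blast
  show ?thesis
    by (rule lborel_integral_eq_cbox(1)[OF assms(1), of "- a" a]) (use a assms(2) in \<open>force simp: not_le\<close>)
qed

lemma lborel_integral_affine:
  fixes F :: "'a::euclidean_space \<Rightarrow> 'b::euclidean_space"
  assumes "continuous_on UNIV F" "r > 0"
  shows "integral\<^sup>L lborel (\<lambda>y. F (x + r *\<^sub>R y)) = inverse r ^ DIM('a) *\<^sub>R integral\<^sup>L lborel F"
proof -
  have [measurable]: "F \<in> borel_measurable borel"
    using assms(1) by (rule borel_measurable_continuous_onI)
  have "integral\<^sup>L lborel F =
      integral\<^sup>L (density (distr lborel borel (\<lambda>y. x + r *\<^sub>R y)) (\<lambda>_. ennreal (\<bar>r\<bar> ^ DIM('a)))) F"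
    by (subst lborel_affine[of r x]) (use assms(2) in \<open>simp_all add: ennreal_power\<close>)
  also have "\<dots> = \<bar>r\<bar> ^ DIM('a) *\<^sub>R integral\<^sup>L lborel (\<lambda>y. F (x + r *\<^sub>R y))"
    by (subst integral_density) (auto simp: integral_distr)
  finally show ?thesis using assms(2) by (simp add: power_inverse)
qed

lemma radial_has_derivative:
  fixes x z :: "'a::real_inner"
  assumes "derivative_sequence G"
  shows "((\<lambda>z. G n (c * (norm (z - x))\<^sup>2)) has_derivative
    (\<lambda>h. G (Suc n) (c * (norm (z - x))\<^sup>2) * (2 * c * ((z - x) \<bullet> h)))) (at z)"
proof -
  have "((\<lambda>z. c * (norm (z - x))\<^sup>2) has_derivative (\<lambda>h. 2 * c * ((z - x) \<bullet> h))) (at z)"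
    unfolding power2_norm_eq_inner
    by (auto intro!: derivative_eq_intros simp: inner_commute)
  from has_derivative_compose[OF this derivative_sequence_deriv[OF assms, of n, unfolded has_field_derivative_def]]
  show ?thesis .
qed

text \<open>For q = c |z - x|^2 one has \<Delta>(G(q)) = G'(q) \<Delta>q + G''(q) |grad q|^2, where
  \<Delta>q = 2 d c and |grad q|^2 = 4 c^2 |z - x|^2.\<close>

lemma radial_laplacian:
  fixes x z :: "real^'d"
  assumes "derivative_sequence G"
  shows "laplacian (\<lambda>z. of_real (G 0 (c * (norm (z - x))\<^sup>2))) z =
    of_real (2 * real CARD('d) * c * G 1 (c * (norm (z - x))\<^sup>2)
      + 4 * c\<^sup>2 * (norm (z - x))\<^sup>2 * G 2 (c * (norm (z - x))\<^sup>2))"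
proof -
  let ?q = "\<lambda>z. c * (norm (z - x))\<^sup>2"
  have 1: "partial_derivative i (\<lambda>z. of_real (G 0 (?q z))) =
      (\<lambda>z. of_real (G 1 (?q z) * (2 * c * ((z - x) \<bullet> axis i 1))))" for i
    using partial_derivative_eqI[OF has_derivative_of_real[OF radial_has_derivative[OF assms, of 0 c x]]]
    by auto
  have 2: "partial_derivative i (\<lambda>z. of_real (G 1 (?q z) * (2 * c * ((z - x) \<bullet> axis i 1)))) z =
      of_real (G 1 (?q z) * (2 * c) + 4 * c\<^sup>2 * G 2 (?q z) * ((z - x) $ i)\<^sup>2)" for i
  proof -
    have "((\<lambda>z. G 1 (?q z) * (2 * c * ((z - x) \<bullet> axis i 1))) has_derivative
        (\<lambda>h. G 1 (?q z) * (2 * c * (h \<bullet> axis i 1)) +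
          G (Suc 1) (?q z) * (2 * c * ((z - x) \<bullet> h)) * (2 * c * ((z - x) \<bullet> axis i 1)))) (at z)"
      by (rule has_derivative_mult[OF radial_has_derivative[OF assms]]) (auto intro!: derivative_eq_intros)
    note eq = partial_derivative_eqI[OF has_derivative_of_real[OF this]]
    show ?thesis
      by (rule trans[OF eq]) (simp add: inner_axis power2_eq_square algebra_simps numeral_2_eq_2)
  qed
  have sq: "(\<Sum>i\<in>UNIV. ((z - x) $ i)\<^sup>2) = (norm (z - x))\<^sup>2"
    unfolding power2_norm_eq_inner inner_vec_def by (simp add: power2_eq_square)
  show ?thesis
    unfolding laplacian_def 1 2 of_real_sum[symmetric] sum.distrib sum_distrib_left[symmetric] sq
    by (simp add: algebra_simps)
qed

lemma radial_Cc_infinity: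
  fixes x :: "real^'d"
  assumes "derivative_sequence G" "\<And>t. t \<ge> 1 \<Longrightarrow> G n t = 0" "0 < r" "r < R"
  shows "(\<lambda>z. of_real (G n (1 / r\<^sup>2 * (norm (z - x))\<^sup>2))) \<in> Cc_infinity (ball x R)"
proof (rule Cc_infinityI[of _ "cball x r"])
  show "smooth (\<lambda>z. of_real (G n (1 / r\<^sup>2 * (norm (z - x))\<^sup>2)))"
    by (rule smooth_compose[OF assms(1) smooth_norm_sq])
  show "cball x r \<subseteq> ball x R" using assms by auto
  show "of_real (G n (1 / r\<^sup>2 * (norm (z - x))\<^sup>2)) = 0" if "z \<notin> cball x r" for z
  proof -
    have "r \<le> norm (z - x)" using that by (simp add: dist_norm norm_minus_commute)
    then have "r\<^sup>2 \<le> (norm (z - x))\<^sup>2" using assms by (intro power_mono) auto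
    then show ?thesis using assms by (simp add: divide_simps)
  qed
qed simp

text \<open>The weight is not normalised. Integrating over the unscaled \<open>y\<close> keeps
  radius 0 admissible, where the value is \<open>u x\<close> times the total weight.\<close>

definition radial_mean :: "(real \<Rightarrow> real) \<Rightarrow> (real^'d \<Rightarrow> complex) \<Rightarrow> real^'d \<Rightarrow> real \<Rightarrow> complex" where
  "radial_mean g u x r = (LINT y|lborel. u (x + r *\<^sub>R y) * of_real (g ((norm y)\<^sup>2)))"

text \<open>Global continuity settles integrability against test functions, while the identity is
  tested inside \<open>N\<close> only. In the application \<open>u\<close> and \<open>w\<close> are
  images under \<open>U\<close>, of interest only on a ball.\<close>

definition weak_laplacian :: "(real^'d) set \<Rightarrow> (real^'d \<Rightarrow> complex) \<Rightarrow> (real^'d \<Rightarrow> complex) \<Rightarrow> bool" where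
  "weak_laplacian N u w \<longleftrightarrow> continuous_on UNIV u \<and> continuous_on UNIV w \<and>
    (\<forall>\<phi>\<in>Cc_infinity N. (LINT z|lborel. u z * laplacian \<phi> z) = (LINT z|lborel. w z * \<phi> z))"

lemma weak_laplacian_mono: "weak_laplacian N u w \<Longrightarrow> M \<subseteq> N \<Longrightarrow> weak_laplacian M u w"
  using Cc_infinity_mono unfolding weak_laplacian_def by blast

text \<open>Two families are used: \<open>bump\<close>, and \<open>bump\<close> shifted by one
  index, whose \<open>G 1\<close> is \<open>bump 2\<close>.\<close>

context
  fixes G :: "nat \<Rightarrow> real \<Rightarrow> real"
  assumes G: "derivative_sequence G" and G_vanish: "\<forall>n. \<forall>t\<ge>1. G n t = 0"
begin

lemma G_eq_0: "t \<ge> 1 \<Longrightarrow> G n t = 0"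
  using G_vanish by blast

lemma G_norm_0: "norm y \<ge> 1 \<Longrightarrow> G n ((norm y)\<^sup>2) = 0"
  by (intro G_eq_0) (simp add: one_le_power)

lemma radial_integrable:
  fixes F :: "'a::euclidean_space \<Rightarrow> complex"
  assumes "continuous_on UNIV F"
  shows "integrable lborel (\<lambda>y. F y * of_real (G n ((norm y)\<^sup>2)))"
  by (rule lborel_integrable_bounded_support[where R = 1])
    (auto intro!: continuous_intros assms derivative_sequence_continuous_on[OF G] simp: G_norm_0)

lemma radial_mean_continuous_on:
  fixes x :: "real^'d"
  assumes "continuous_on UNIV u"
  shows "continuous_on S (radial_mean (G n) u x)"
proof -
  obtain a :: "real^'d" where a: "cball 0 1 \<subseteq> cbox (- a) a"
    using bounded_subset_cbox_symmetric[OF bounded_cball] by blast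
  have "continuous_on S (\<lambda>r. integral (cbox (- a) a) (\<lambda>y. u (x + r *\<^sub>R y) * of_real (G n ((norm y)\<^sup>2))))"
    by (intro integral_continuous_on_param)
      (auto simp: split_beta intro!: continuous_intros continuous_on_compose2[OF assms]
        derivative_sequence_continuous_on[OF G])
  moreover have "radial_mean (G n) u x r = integral (cbox (- a) a) (\<lambda>y. u (x + r *\<^sub>R y) * of_real (G n ((norm y)\<^sup>2)))" for r
    unfolding radial_mean_def
  proof (rule lborel_integral_eq_cbox(2))
    show "continuous_on UNIV (\<lambda>y. u (x + r *\<^sub>R y) * of_real (G n ((norm y)\<^sup>2)))"
      by (auto intro!: continuous_intros continuous_on_compose2[OF assms]
        derivative_sequence_continuous_on[OF G])
    show "u (x + r *\<^sub>R y) * of_real (G n ((norm y)\<^sup>2)) = 0" if "y \<notin> cbox (- a) a" for y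
      using that a G_norm_0[of y n] by force
  qed
  ultimately show ?thesis by presburger
qed

lemma radial_mean_0:
  fixes x :: "real^'d"
  shows "radial_mean (G n) u x 0 = u x * of_real (LINT y|(lborel :: (real^'d) measure). G n ((norm y)\<^sup>2))"
  by (simp add: radial_mean_def)

lemma radial_mean_rescale:
  fixes x :: "real^'d"
  assumes "continuous_on UNIV u" "r > 0"
  shows "radial_mean (G n) u x r =
    of_real (inverse r ^ CARD('d)) * (LINT z|lborel. u z * of_real (G n (1 / r\<^sup>2 * (norm (z - x))\<^sup>2)))"
proof -
  let ?F = "\<lambda>z. u z * of_real (G n (1 / r\<^sup>2 * (norm (z - x))\<^sup>2))"
  have F: "continuous_on UNIV ?F"
    using assms(2) by (auto intro!: continuous_intros assms(1) derivative_sequence_continuous_on[OF G])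
  have "radial_mean (G n) u x r = (LINT y|lborel. ?F (x + r *\<^sub>R y))"
    using assms(2) by (simp add: radial_mean_def power_mult_distrib)
  then show ?thesis
    using lborel_integral_affine[OF F assms(2), of x] by (simp add: scaleR_conv_of_real)
qed

text \<open>
  The kernels \<open>r\<^sup>-\<^sup>d G' (\<bar>z - x\<bar>\<^sup>2 / r\<^sup>2)\<close> have the \<open>r\<close>-derivative \<open>- (r / 2) r\<^sup>-\<^sup>d \<Delta>\<^sub>z (G (\<bar>z - x\<bar>\<^sup>2 / r\<^sup>2))\<close>,
  so the dependence of a radial mean on its radius is governed by the Laplacian.
\<close>

lemma radial_mean_has_derivative:
  fixes x :: "real^'d"
  assumes weak: "weak_laplacian (ball x R) u w" and r: "0 < r" "r < R"
  shows "(radial_mean (G 1) u x has_vector_derivative (- (r / 2)) *\<^sub>R radial_mean (G 0) w x r) (at r)"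
proof -
  let ?d = "CARD('d)"
  have u: "continuous_on UNIV u" and w: "continuous_on UNIV w"
    using weak by (auto simp: weak_laplacian_def)
  \<comment> \<open>One box serves all radii below \<open>R\<close>, so that Leibniz's rule sees a
    fixed domain of integration.\<close>
  obtain a where a: "ball x R \<subseteq> cbox (- a) a"
    using bounded_subset_cbox_symmetric[OF bounded_ball] by blast
  define q where "q r z = 1 / r\<^sup>2 * (norm (z - x))\<^sup>2" for r and z :: "real^'d"
  define k where "k r z = inverse r ^ ?d * G 1 (q r z)" for r z
  \<comment> \<open>This is -(r/2) r^(-d) times the value in \<open>radial_laplacian\<close> at c =
    1/r^2; \<open>kd\<close> shows that it is also the derivative of \<open>k\<close> in
    \<open>r\<close>.\<close>
  define k' where "k' r z = - (r / 2) * inverse r ^ ?d * (2 * real ?d * (1 / r\<^sup>2) * G 1 (q r z)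
      + 4 * (1 / r\<^sup>2)\<^sup>2 * (norm (z - x))\<^sup>2 * G 2 (q r z))" for r z
  have zero: "G n (q s z) = 0" if "z \<notin> cbox (- a) a" "0 < s" "s < R" for n s z
  proof -
    have "z \<notin> ball x R" using that a by blast
    then have "s \<le> norm (z - x)" using that by (simp add: dist_norm norm_minus_commute)
    then have "s\<^sup>2 \<le> (norm (z - x))\<^sup>2" using that by (intro power_mono) auto
    then show ?thesis unfolding q_def using that by (intro G_eq_0) (simp add: divide_simps)
  qed
  have kd: "((\<lambda>r. k r z) has_real_derivative k' r z) (at r)" if "r > 0" for r z
  proof -
    have dq: "((\<lambda>r. q r z) has_real_derivative - 2 / r ^ 3 * (norm (z - x))\<^sup>2) (at r)"
      unfolding q_def using that
      by (auto intro!: derivative_eq_intros simp: power2_eq_square power3_eq_cube field_simps)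
    have dG: "((\<lambda>r. G 1 (q r z)) has_real_derivative G 2 (q r z) * (- 2 / r ^ 3 * (norm (z - x))\<^sup>2)) (at r)"
      using DERIV_chain2[OF derivative_sequence_deriv[OF G, of 1] dq] by (simp add: numeral_2_eq_2)
    have di: "((\<lambda>r. inverse r ^ ?d) has_real_derivative - (real ?d * inverse r ^ ?d * inverse r)) (at r)"
    proof -
      obtain m where m: "?d = Suc m" using not0_implies_Suc[of ?d] by auto
      show ?thesis unfolding m using that
        by (intro DERIV_cong[OF DERIV_power[OF DERIV_inverse]]) auto
    qed
    show ?thesis
      unfolding k_def
      by (rule DERIV_cong[OF DERIV_mult[OF di dG]])
        (use that in \<open>simp add: k'_def power2_eq_square power3_eq_cube field_simps\<close>)
  qed
  have M: "radial_mean (G 1) u x s = integral (cbox (- a) a) (\<lambda>z. u z * of_real (k s z))"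
    if "0 < s" "s < R" for s
  proof -
    have "radial_mean (G 1) u x s = (LINT z|lborel. u z * of_real (k s z))"
      using radial_mean_rescale[OF u, of s 1 x] that
      by (simp add: k_def q_def mult.left_commute flip: integral_mult_right_zero)
    also have "\<dots> = integral (cbox (- a) a) (\<lambda>z. u z * of_real (k s z))"
      unfolding k_def
      by (rule lborel_integral_eq_cbox(2))
        (use that zero in \<open>auto simp: q_def intro!: continuous_intros u derivative_sequence_continuous_on[OF G]\<close>)
    finally show ?thesis .
  qed
  have "((\<lambda>s. integral (cbox (- a) a) (\<lambda>z. u z * of_real (k s z))) has_vector_derivative
      integral (cbox (- a) a) (\<lambda>z. u z * of_real (k' r z))) (at r within {0<..<R})"
  proof (rule leibniz_rule_vector_derivative)
    show "((\<lambda>s. u z * of_real (k s z)) has_vector_derivative u z * of_real (k' s z)) (at s within {0<..<R})"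
      if "s \<in> {0<..<R}" for s z
    proof -
      have "((\<lambda>s. u z * of_real (k s z)) has_vector_derivative u z * of_real (k' s z)) (at s)"
        using kd[of s z] that by (intro has_vector_derivative_mult_right has_vector_derivative_of_real) auto
      then show ?thesis by (rule has_vector_derivative_at_within)
    qed
    show "(\<lambda>z. u z * of_real (k s z)) integrable_on cbox (- a) a" if "s \<in> {0<..<R}" for s
      unfolding k_def q_def
      by (intro integrable_continuous continuous_intros continuous_on_subset[OF u]
        derivative_sequence_continuous_on[OF G]) auto
    show "continuous_on ({0<..<R} \<times> cbox (- a) a) (\<lambda>(s, z). u z * of_real (k' s z))"
      unfolding k'_def q_def split_beta
      by (intro continuous_intros continuous_on_compose2[OF u]
        derivative_sequence_continuous_on[OF G]) auto
  qed (use r in auto)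
  then have "((\<lambda>s. integral (cbox (- a) a) (\<lambda>z. u z * of_real (k s z))) has_vector_derivative
      integral (cbox (- a) a) (\<lambda>z. u z * of_real (k' r z))) (at r)"
    using r by (simp add: at_within_open[of r "{0<..<R}"])
  then have 1: "(radial_mean (G 1) u x has_vector_derivative
      integral (cbox (- a) a) (\<lambda>z. u z * of_real (k' r z))) (at r)"
    by (rule has_vector_derivative_transform_within_open[where S = "{0<..<R}"]) (use r M in auto)
  let ?\<phi> = "\<lambda>z. complex_of_real (G 0 (q r z))"
  have "integral (cbox (- a) a) (\<lambda>z. u z * of_real (k' r z)) = (LINT z|lborel. u z * of_real (k' r z))"
    unfolding k'_def
    by (rule lborel_integral_eq_cbox(2)[symmetric])
      (use r zero in \<open>auto simp: q_def intro!: continuous_intros u derivative_sequence_continuous_on[OF G]\<close>)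
  also have "\<dots> = (LINT z|lborel. of_real (- (r / 2) * inverse r ^ ?d) * (u z * laplacian ?\<phi> z))"
    unfolding q_def radial_laplacian[OF G] k'_def
    by (intro Bochner_Integration.integral_cong) (simp_all add: mult_ac)
  also have "\<dots> = of_real (- (r / 2) * inverse r ^ ?d) * (LINT z|lborel. u z * laplacian ?\<phi> z)"
    by (rule integral_mult_right_zero)
  also have "(LINT z|lborel. u z * laplacian ?\<phi> z) = (LINT z|lborel. w z * ?\<phi> z)"
    using weak radial_Cc_infinity[OF G, where x = x and n = 0, OF G_eq_0 r]
    by (simp add: weak_laplacian_def q_def)
  also have "of_real (- (r / 2) * inverse r ^ ?d) * \<dots> = (- (r / 2)) *\<^sub>R radial_mean (G 0) w x r"
    using radial_mean_rescale[OF w r(1), of 0 x] by (simp add: q_def scaleR_conv_of_real)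
  finally show ?thesis using 1 by simp
qed

text \<open>The derivative in the radius vanishes by \<open>radial_mean_has_derivative\<close>, and
  continuity down to radius 0 identifies the constant.\<close>

lemma radial_mean_harmonic:
  fixes x :: "real^'d"
  assumes weak: "weak_laplacian (ball x R) u w" and w: "\<And>z. z \<in> ball x R \<Longrightarrow> w z = 0"
    and r: "0 \<le> r" "r < R"
  shows "radial_mean (G 1) u x r = u x * of_real (LINT y|(lborel :: (real^'d) measure). G 1 ((norm y)\<^sup>2))"
proof (cases "r = 0")
  case False
  have u: "continuous_on UNIV u" using weak by (simp add: weak_laplacian_def)
  have W: "radial_mean (G 0) w x s = 0" if "0 < s" "s < r" for s
  proof -
    have "w (x + s *\<^sub>R y) * of_real (G 0 ((norm y)\<^sup>2)) = 0" for y
    proof (cases "norm y < 1")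
      case True
      have "norm (s *\<^sub>R y) \<le> s" using that(1) True by (simp add: mult_left_le)
      then have "norm (s *\<^sub>R y) < R" using that r by linarith
      then show ?thesis using w[of "x + s *\<^sub>R y"] by (simp add: dist_norm)
    qed (simp add: G_norm_0)
    then show ?thesis unfolding radial_mean_def by (simp only: integral_zero)
  qed
  have "norm (radial_mean (G 1) u x r - radial_mean (G 1) u x 0) \<le> 0 - (0::real)"
  proof (rule differentiable_bound_general[where \<phi> = "\<lambda>_. 0" and \<phi>' = "\<lambda>_. 0"])
    show "(radial_mean (G 1) u x has_vector_derivative 0) (at s)" if "0 < s" "s < r" for s
      using radial_mean_has_derivative[OF weak, of s] W[OF that] that r by simp
  qed (use r False in \<open>auto intro: radial_mean_continuous_on u\<close>)
  then show ?thesis by (simp add: radial_mean_0)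
qed (simp add: radial_mean_0)

text \<open>The mean M of \<open>u\<close> has derivative -(s/2) W(s), with W the mean of
  \<open>w\<close> for the weight \<open>G 0\<close>. Integrating with W(s) close to W(0) gives the
  coefficient -1/4.\<close>

lemma radial_mean_second_order:
  fixes x :: "real^'d"
  assumes weak: "weak_laplacian (ball x R) u w" and R: "R > 0"
  shows "((\<lambda>r. (radial_mean (G 1) u x r - radial_mean (G 1) u x 0) /\<^sub>R r\<^sup>2) \<longlongrightarrow>
    (- 1 / 4) *\<^sub>R radial_mean (G 0) w x 0) (at_right 0)"
proof (rule tendstoI)
  fix e :: real assume e: "e > 0"
  have u: "continuous_on UNIV u" and w: "continuous_on UNIV w"
    using weak by (auto simp: weak_laplacian_def)
  let ?M = "radial_mean (G 1) u x" and ?W = "radial_mean (G 0) w x"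
  have "continuous_on UNIV ?W" by (rule radial_mean_continuous_on[OF w])
  then have "\<exists>d>0. \<forall>r. dist r 0 < d \<longrightarrow> dist (?W r) (?W 0) < e"
    using e unfolding continuous_on_iff by blast
  then obtain d where d: "d > 0" "\<And>r. \<bar>r\<bar> < d \<Longrightarrow> norm (?W r - ?W 0) < e"
    by (auto simp: dist_norm)
  have "dist ((?M r - ?M 0) /\<^sub>R r\<^sup>2) ((- 1 / 4) *\<^sub>R ?W 0) < e" if r: "0 < r" "r < min d R" for r
  proof -
    \<comment> \<open>Adding the expected quadratic term leaves the derivative -(s/2) (W(s) - W(0)),
      of norm at most e s / 2, which the mean value inequality compares with e r^2 / 4.\<close>
    let ?N = "\<lambda>r. ?M r + (r\<^sup>2 / 4) *\<^sub>R ?W 0"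
    have "norm (?N r - ?N 0) \<le> e * r\<^sup>2 / 4 - e * 0\<^sup>2 / 4"
    proof (rule differentiable_bound_general[where \<phi> = "\<lambda>r. e * r\<^sup>2 / 4" and \<phi>' = "\<lambda>r. e * r / 2"])
      show "(?N has_vector_derivative (- (s / 2)) *\<^sub>R (?W s - ?W 0)) (at s)" if "0 < s" "s < r" for s
      proof -
        have "((\<lambda>r. (r\<^sup>2 / 4) *\<^sub>R ?W 0) has_vector_derivative (s / 2) *\<^sub>R ?W 0) (at s)"
          by (rule has_vector_derivative_eq_rhs[OF has_vector_derivative_scaleR[OF _ has_vector_derivative_const]])
            (auto intro!: derivative_eq_intros)
        from has_vector_derivative_add[OF radial_mean_has_derivative[OF weak, of s] this] show ?thesis
          using that r by (simp add: algebra_simps)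
      qed
      show "norm ((- (s / 2)) *\<^sub>R (?W s - ?W 0)) \<le> e * s / 2" if "0 < s" "s < r" for s
      proof -
        have "norm (?W s - ?W 0) \<le> e" using d(2)[of s] that r by auto
        then have "s * norm (?W s - ?W 0) \<le> s * e" using that by (intro mult_left_mono) auto
        moreover have "norm ((- (s / 2)) *\<^sub>R (?W s - ?W 0)) = s * norm (?W s - ?W 0) / 2"
          unfolding norm_scaleR using that by simp
        ultimately show ?thesis by (simp only: mult.commute divide_right_mono)
      qed
      show "((\<lambda>r. e * r\<^sup>2 / 4) has_vector_derivative e * s / 2) (at s)" for s
        unfolding has_real_derivative_iff_has_vector_derivative[symmetric]
        by (auto intro!: derivative_eq_intros)
      show "continuous_on {0..r} ?N"
        by (intro continuous_intros radial_mean_continuous_on u) simp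
    qed (use r in \<open>auto intro!: continuous_intros\<close>)
    then have N: "norm (?M r - ?M 0 + (r\<^sup>2 / 4) *\<^sub>R ?W 0) \<le> e * r\<^sup>2 / 4" by (simp add: algebra_simps)
    have eq: "(?M r - ?M 0) /\<^sub>R r\<^sup>2 - (- 1 / 4) *\<^sub>R ?W 0 = (?M r - ?M 0 + (r\<^sup>2 / 4) *\<^sub>R ?W 0) /\<^sub>R r\<^sup>2"
      using r by (simp add: algebra_simps)
    have "dist ((?M r - ?M 0) /\<^sub>R r\<^sup>2) ((- 1 / 4) *\<^sub>R ?W 0) =
        norm (?M r - ?M 0 + (r\<^sup>2 / 4) *\<^sub>R ?W 0) / r\<^sup>2"
      unfolding dist_norm eq norm_scaleR divide_inverse_commute[of _ "r\<^sup>2"] by simp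
    also have "\<dots> \<le> (e * r\<^sup>2 / 4) / r\<^sup>2" using N by (intro divide_right_mono) auto
    also have "\<dots> < e" using r e by simp
    finally show ?thesis .
  qed
  then show "\<forall>\<^sub>F r in at_right 0. dist ((?M r - ?M 0) /\<^sub>R r\<^sup>2) ((- 1 / 4) *\<^sub>R ?W 0) < e"
    unfolding eventually_at_right_field using d(1) R by (intro exI[of _ "min d R"]) auto
qed

text \<open>The weight lives on the unit ball, so uniform convergence there passes to the integral;
  \<open>C\<close> is the L1 norm of the weight.\<close>

lemma radial_mean_quadratic_limit:
  fixes x :: "real^'d"
  assumes u: "continuous_on UNIV u" and q: "continuous_on UNIV q"
    and lim: "\<And>e. e > 0 \<Longrightarrow> \<exists>d>0. \<forall>r y. 0 < r \<longrightarrow> r < d \<longrightarrow> norm y \<le> 1 \<longrightarrow> norm (u (x + r *\<^sub>R y) /\<^sub>R r\<^sup>2 - q y) \<le> e"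
  shows "((\<lambda>r. radial_mean (G n) u x r /\<^sub>R r\<^sup>2) \<longlongrightarrow> (LINT y|lborel. q y * of_real (G n ((norm y)\<^sup>2)))) (at_right 0)"
proof (rule tendstoI)
  fix e :: real assume e: "e > 0"
  let ?g = "\<lambda>y::real^'d. G n ((norm y)\<^sup>2)"
  have int_g: "integrable lborel ?g"
    by (rule lborel_integrable_bounded_support[where R = 1])
      (auto intro!: continuous_intros derivative_sequence_continuous_on[OF G] simp: G_norm_0)
  define C where "C = (LINT y|lborel. \<bar>?g y\<bar>)"
  have C: "C \<ge> 0" by (simp add: C_def)
  define e' where "e' = e / (C + 1)"
  have e': "e' > 0" "e' * C < e" using e C by (auto simp: e'_def field_simps)
  obtain d where d: "d > 0" "\<And>r y. 0 < r \<Longrightarrow> r < d \<Longrightarrow> norm y \<le> 1 \<Longrightarrow> norm (u (x + r *\<^sub>R y) /\<^sub>R r\<^sup>2 - q y) \<le> e'"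
    using lim[OF e'(1)] by blast
  have "dist (radial_mean (G n) u x r /\<^sub>R r\<^sup>2) (LINT y|lborel. q y * of_real (?g y)) < e"
    if r: "0 < r" "r < d" for r
  proof -
    have i1: "integrable lborel (\<lambda>y. u (x + r *\<^sub>R y) * of_real (?g y))"
      by (intro radial_integrable continuous_on_compose2[OF u]) (auto intro!: continuous_intros)
    have i2: "integrable lborel (\<lambda>y. q y * of_real (?g y))" by (rule radial_integrable[OF q])
    have "radial_mean (G n) u x r /\<^sub>R r\<^sup>2 - (LINT y|lborel. q y * of_real (?g y)) =
        (LINT y|lborel. (u (x + r *\<^sub>R y) * of_real (?g y)) /\<^sub>R r\<^sup>2 - q y * of_real (?g y))"
      unfolding radial_mean_def using i1 i2 by simp
    also have "\<dots> = (LINT y|lborel. (u (x + r *\<^sub>R y) /\<^sub>R r\<^sup>2 - q y) * of_real (?g y))"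
      by (simp add: algebra_simps)
    also have "norm \<dots> \<le> (LINT y|lborel. norm ((u (x + r *\<^sub>R y) /\<^sub>R r\<^sup>2 - q y) * of_real (?g y)))"
      by (rule integral_norm_bound)
    also have "\<dots> \<le> (LINT y|lborel. e' * \<bar>?g y\<bar>)"
    proof (rule integral_mono)
      show "integrable lborel (\<lambda>y. norm ((u (x + r *\<^sub>R y) /\<^sub>R r\<^sup>2 - q y) * of_real (?g y)))"
        by (intro integrable_norm radial_integrable continuous_intros q continuous_on_compose2[OF u]) auto
      show "norm ((u (x + r *\<^sub>R y) /\<^sub>R r\<^sup>2 - q y) * of_real (?g y)) \<le> e' * \<bar>?g y\<bar>" for y
      proof (cases "norm y \<le> 1")
        case True
        then show ?thesis using d(2)[OF r True] by (simp add: norm_mult mult_right_mono)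
      qed (simp add: G_norm_0)
    qed (use int_g in auto)
    also have "\<dots> = e' * C" by (simp add: C_def)
    finally show ?thesis using e' by (simp add: dist_norm)
  qed
  then show "\<forall>\<^sub>F r in at_right 0. dist (radial_mean (G n) u x r /\<^sub>R r\<^sup>2) (LINT y|lborel. q y * of_real (?g y)) < e"
    unfolding eventually_at_right_field using d(1) by (intro exI[of _ d]) auto
qed

end

section \<open>Bump weights and the smoothness of weakly harmonic functions\<close>

lemma lborel_integral_pos:
  fixes f :: "'a::euclidean_space \<Rightarrow> real"
  assumes f: "continuous_on UNIV f" "integrable lborel f" "\<And>x. 0 \<le> f x" "0 < f a"
  shows "0 < integral\<^sup>L lborel f"
proof -
  obtain d where d: "d > 0" "\<And>x. dist x a < d \<Longrightarrow> dist (f x) (f a) < f a / 2"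
    using f(1,4) unfolding continuous_on_iff by (meson UNIV_I half_gt_zero)
  have "0 < measure lborel (ball a d) * (f a / 2)"
    using f(4) content_ball_pos[OF d(1)] by simp
  also have "\<dots> = (LINT x|lborel. indicator (ball a d) x * (f a / 2))" by simp
  also have "\<dots> \<le> integral\<^sup>L lborel f"
  proof (rule integral_mono)
    show "integrable lborel (\<lambda>x. indicator (ball a d) x * (f a / 2))"
      using emeasure_bounded_finite[OF bounded_ball, of a d]
      by (intro integrable_mult_left integrable_real_indicator) auto
    show "indicator (ball a d) x * (f a / 2) \<le> f x" for x
    proof (cases "x \<in> ball a d")
      case True
      then have "dist x a < d" by (simp add: dist_commute)
      from d(2)[OF this] have "f a / 2 \<le> f x" unfolding dist_real_def by linarith
      then show ?thesis using True by simp
    qed (use f(3) in simp)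
  qed (use f(2) in auto)
  finally show ?thesis .
qed

text \<open>The type argument fixes the dimension, which the real result would not
  determine.\<close>

definition bump_mass :: "'d::finite itself \<Rightarrow> nat \<Rightarrow> real" where
  "bump_mass T n = (LINT y|(lborel :: (real^'d) measure). bump n ((norm y)\<^sup>2))"

lemma bump_continuous_on [continuous_intros]: "continuous_on S q \<Longrightarrow> continuous_on S (\<lambda>x. bump n (q x))"
  by (rule derivative_sequence_continuous_on[OF derivative_sequence_bump])

lemma bump_norm_0: "norm y \<ge> 1 \<Longrightarrow> bump n ((norm y)\<^sup>2) = 0"
  by (intro bump_eq_0) (simp add: one_le_power)

lemma bump_vanish: "\<forall>n. \<forall>t\<ge>1. bump n t = 0"
  by (simp add: bump_eq_0)

lemma bump_integrable: "integrable lborel (\<lambda>y::'a::euclidean_space. bump n ((norm y)\<^sup>2))"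
  by (rule lborel_integrable_bounded_support[where R = 1])
    (auto intro!: continuous_intros simp: bump_norm_0)

lemma bump_mass_0_pos: "bump_mass TYPE('d::finite) 0 > 0"
  unfolding bump_mass_def
proof (rule lborel_integral_pos[where a = 0])
  show "0 \<le> bump 0 ((norm y)\<^sup>2)" for y :: "real^'d"
    by (cases "norm y < 1") (use bump_norm_0[of y 0] in \<open>auto intro!: less_imp_le bump_0_pos simp: abs_square_less_1\<close>)
qed (auto intro!: continuous_intros bump_integrable bump_0_pos)

text \<open>A nonzero mass lets the mean value property be solved for the value at the
  centre.\<close>

lemma bump_mass_1_neg: "bump_mass TYPE('d::finite) 1 < 0"
proof -
  have "0 < (LINT y|(lborel :: (real^'d) measure). - bump 1 ((norm y)\<^sup>2))"
    by (rule lborel_integral_pos[where a = 0])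
      (use bump_1_nonpos bump_1_neg[of 0] bump_integrable in \<open>auto intro!: continuous_intros\<close>)
  then show ?thesis by (simp add: bump_mass_def)
qed

text \<open>Leibniz's rule is applied on one box containing the supports of z |-> k(z - x) for all x
  in the ball. The derivative is a continuous family of bounded linear maps because the inverse
  function theorem will ask for one. The minus sign is the inner derivative of z - x.\<close>

lemma convolution_has_derivative:
  fixes u :: "'a::euclidean_space \<Rightarrow> complex" and k :: "'a \<Rightarrow> real" and k' :: "'a \<Rightarrow> 'a \<Rightarrow>\<^sub>L real"
  assumes u: "continuous_on UNIV u" and k: "\<And>z. (k has_derivative k' z) (at z)"
    and k': "continuous_on UNIV k'"
    and zero: "\<And>z. norm z \<ge> R \<Longrightarrow> k z = 0" "\<And>z. norm z \<ge> R \<Longrightarrow> k' z = 0"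
  obtains D :: "'a \<Rightarrow> 'a \<Rightarrow>\<^sub>L complex" where "continuous_on (ball x\<^sub>0 \<rho>) D"
    "\<And>x. x \<in> ball x\<^sub>0 \<rho> \<Longrightarrow> ((\<lambda>x. LINT z|lborel. u z * of_real (k (z - x))) has_derivative D x) (at x)"
    "\<And>x b. x \<in> ball x\<^sub>0 \<rho> \<Longrightarrow> D x b = - (LINT z|lborel. u z * of_real (k' (z - x) b))"
proof -
  obtain a where a: "ball x\<^sub>0 (\<rho> + R) \<subseteq> cbox (- a) a"
    using bounded_subset_cbox_symmetric[OF bounded_ball] by blast
  have outside: "norm (z - x) \<ge> R" if "x \<in> ball x\<^sub>0 \<rho>" "z \<notin> cbox (- a) a" for x z
  proof -
    have "\<rho> + R \<le> dist x\<^sub>0 z" using that a by (meson in_mono mem_ball not_le)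
    also have "\<dots> \<le> dist x\<^sub>0 x + dist x z" by (rule dist_triangle)
    finally show ?thesis using that by (simp add: dist_norm norm_minus_commute)
  qed
  have k_cont: "continuous_on UNIV k"
    using k by (meson continuous_at_imp_continuous_on has_derivative_continuous)
  define fx where "fx x z = - (blinfun_scaleR_left (u z) o\<^sub>L k' (z - x))" for x z
  define D where "D x = integral (cbox (- a) a) (fx x)" for x
  have fx_cont: "continuous_on S (\<lambda>(x, z). fx x z)" for S
    unfolding fx_def split_beta
    by (intro continuous_intros continuous_on_compose2[OF u] continuous_on_compose2[OF k']
      bounded_linear.continuous_on[OF bounded_linear_blinfun_scaleR_left]
      bounded_bilinear.continuous_on[OF bounded_bilinear_blinfun_compose]) auto
  have "continuous_on S (\<lambda>z. case (x, z) of (x, z) \<Rightarrow> fx x z)" for S x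
    by (rule continuous_on_compose2[OF fx_cont[of UNIV]]) (auto intro!: continuous_intros)
  then have fx_cont1: "continuous_on S (\<lambda>z. fx x z)" for S x by simp
  show thesis
  proof
    show "continuous_on (ball x\<^sub>0 \<rho>) D"
      unfolding D_def by (intro integral_continuous_on_param fx_cont)
    fix x assume x: "x \<in> ball x\<^sub>0 \<rho>"
    have "((\<lambda>x. integral (cbox (- a) a) (\<lambda>z. u z * of_real (k (z - x)))) has_derivative D x)
        (at x within ball x\<^sub>0 \<rho>)"
      unfolding D_def
    proof (rule leibniz_rule)
      show "((\<lambda>x. u z * of_real (k (z - x))) has_derivative fx y z) (at y within ball x\<^sub>0 \<rho>)" for y z
      proof -
        have "((\<lambda>x. z - x) has_derivative (\<lambda>h. - h)) (at y)"
          by (auto intro!: derivative_eq_intros)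
        from has_derivative_compose[OF this k]
        have "((\<lambda>x. k (z - x)) has_derivative (\<lambda>h. k' (z - y) (- h))) (at y)" .
        from has_derivative_mult_right[OF has_derivative_of_real[OF this], of "u z"]
        have "((\<lambda>x. u z * of_real (k (z - x))) has_derivative fx y z) (at y)"
          by (rule has_derivative_eq_rhs)
            (auto simp: fx_def blinfun.bilinear_simps scaleR_conv_of_real fun_eq_iff)
        then show ?thesis by (rule has_derivative_at_withinI)
      qed
      show "(\<lambda>z. u z * of_real (k (z - y))) integrable_on cbox (- a) a" for y
        by (intro integrable_continuous continuous_intros continuous_on_compose2[OF k_cont]
          continuous_on_subset[OF u]) auto
    qed (use x fx_cont in auto)
    then have 1: "((\<lambda>x. integral (cbox (- a) a) (\<lambda>z. u z * of_real (k (z - x)))) has_derivative D x) (at x)"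
      using x by (simp add: at_within_open[of x "ball x\<^sub>0 \<rho>"])
    show "((\<lambda>x. LINT z|lborel. u z * of_real (k (z - x))) has_derivative D x) (at x)"
    proof (rule has_derivative_transform_within_open[OF 1 _ x])
      show "integral (cbox (- a) a) (\<lambda>z. u z * of_real (k (z - y))) = (LINT z|lborel. u z * of_real (k (z - y)))"
        if "y \<in> ball x\<^sub>0 \<rho>" for y
        using outside[OF that] zero(1)
        by (intro lborel_integral_eq_cbox(2)[symmetric] continuous_intros u continuous_on_compose2[OF k_cont]) auto
    qed simp
    fix b
    have "fx x integrable_on cbox (- a) a"
      using fx_cont1 by (rule integrable_continuous)
    then have "D x b = integral (cbox (- a) a) (\<lambda>z. fx x z b)"
      unfolding D_def by (rule blinfun_apply_integral)
    also have "\<dots> = (LINT z|lborel. fx x z b)"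
    proof (rule lborel_integral_eq_cbox(2)[symmetric])
      show "continuous_on UNIV (\<lambda>z. fx x z b)"
        by (intro continuous_intros fx_cont1)
      show "fx x z b = 0" if "z \<notin> cbox (- a) a" for z
        using zero(2)[OF outside[OF x that]] by (simp add: fx_def blinfun.bilinear_simps)
    qed
    also have "\<dots> = - (LINT z|lborel. u z * of_real (k' (z - x) b))"
      by (simp add: fx_def blinfun.bilinear_simps scaleR_conv_of_real mult.commute)
    finally show "D x b = - (LINT z|lborel. u z * of_real (k' (z - x) b))" .
  qed
qed

text \<open>The derivative of \<open>bump n (c * (norm z)\<^sup>2)\<close>, encoded as a bounded
  linear map so that its continuity in \<open>z\<close> can be stated.\<close>

definition radial_blinfun :: "nat \<Rightarrow> real \<Rightarrow> 'a::real_inner \<Rightarrow> 'a \<Rightarrow>\<^sub>L real" where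
  "radial_blinfun n c z = (bump (Suc n) (c * (norm z)\<^sup>2) * 2 * c) *\<^sub>R blinfun_inner_right z"

lemma radial_blinfun_apply:
  "radial_blinfun n c z b = bump (Suc n) (c * (norm z)\<^sup>2) * (2 * c * (z \<bullet> b))"
  by (simp add: radial_blinfun_def blinfun.bilinear_simps)

lemma radial_blinfun_has_derivative:
  "((\<lambda>z. bump n (c * (norm z)\<^sup>2)) has_derivative radial_blinfun n c z) (at z)"
  using radial_has_derivative[OF derivative_sequence_bump, of n c 0 z]
  by (simp add: radial_blinfun_apply[abs_def])

lemma radial_blinfun_continuous_on: "continuous_on S (radial_blinfun n c)"
  unfolding radial_blinfun_def
  by (intro continuous_intros bounded_linear.continuous_on[OF bounded_linear_blinfun_inner_right])

text \<open>The integral of \<open>\<partial>\<^sub>b ((b \<bullet> y) G (\<bar>y\<bar>\<^sup>2))\<close> vanishes by translation invariance.\<close>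

lemma bump_second_moment:
  fixes b :: "real^'d"
  shows "(LINT y|lborel. of_real ((b \<bullet> y)\<^sup>2) * complex_of_real (bump 1 ((norm y)\<^sup>2))) =
    of_real (- ((norm b)\<^sup>2 / 2) * bump_mass TYPE('d) 0)"
proof -
  define k :: "real^'d \<Rightarrow> real" where "k z = (b \<bullet> z) * bump 0 (1 * (norm z)\<^sup>2)" for z
  define k' :: "real^'d \<Rightarrow> (real^'d) \<Rightarrow>\<^sub>L real" where
    "k' z = (b \<bullet> z) *\<^sub>R radial_blinfun 0 1 z + bump 0 (1 * (norm z)\<^sup>2) *\<^sub>R blinfun_inner_right b" for z
  have k: "(k has_derivative k' z) (at z)" for z
    unfolding k_def[abs_def]
    by (rule has_derivative_eq_rhs[OF has_derivative_mult[OF _ radial_blinfun_has_derivative]])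
      (auto intro!: derivative_eq_intros simp: k'_def blinfun.bilinear_simps fun_eq_iff mult.commute)
  have k': "continuous_on UNIV k'"
    unfolding k'_def by (intro continuous_intros radial_blinfun_continuous_on)
  have zero: "k z = 0" "k' z = 0" if "norm z \<ge> 1" for z
    using bump_norm_0[OF that] by (auto simp: k_def k'_def radial_blinfun_def)
  obtain D where D: "continuous_on (ball 0 1) D"
    "\<And>x. x \<in> ball 0 1 \<Longrightarrow>
      ((\<lambda>x. LINT z|lborel. 1 * of_real (k (z - x))) has_derivative blinfun_apply (D x)) (at x)"
    "\<And>x b. x \<in> ball 0 1 \<Longrightarrow> D x b = - (LINT z|lborel. 1 * complex_of_real (k' (z - x) b))"
  proof (rule convolution_has_derivative[of "\<lambda>_. 1" k k' 1 0 1], goal_cases)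
    case (6 D)
    show ?case by (rule that; fact 6)
  qed (use k k' zero in auto)
  have k_cont: "continuous_on UNIV (\<lambda>z. complex_of_real (k z))"
    unfolding k_def by (intro continuous_intros)
  have "(LINT z|lborel. 1 * complex_of_real (k (z - x))) = (LINT z|lborel. complex_of_real (k z))" for x
    using lborel_integral_affine[OF k_cont, of 1 "- x"] by simp
  with D(2)[of 0] have "((\<lambda>x::real^'d. LINT z|lborel. complex_of_real (k z)) has_derivative blinfun_apply (D 0)) (at 0)"
    by simp
  from has_derivative_unique[OF this has_derivative_const] have "D 0 b = 0" by simp
  with D(3)[of 0 b] have "0 = (LINT z|lborel. complex_of_real (k' z b))" by simp
  also have "\<dots> = (LINT y|lborel. 2 * (of_real ((b \<bullet> y)\<^sup>2) * complex_of_real (bump 1 ((norm y)\<^sup>2))) +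
      of_real ((norm b)\<^sup>2) * of_real (bump 0 ((norm y)\<^sup>2)))"
    by (intro Bochner_Integration.integral_cong)
      (simp_all add: k'_def radial_blinfun_apply blinfun.bilinear_simps power2_eq_square inner_commute power2_norm_eq_inner[symmetric, unfolded power2_eq_square])
  also have "\<dots> = 2 * (LINT y|lborel. of_real ((b \<bullet> y)\<^sup>2) * complex_of_real (bump 1 ((norm y)\<^sup>2))) +
      of_real ((norm b)\<^sup>2) * of_real (bump_mass TYPE('d) 0)"
  proof -
    have "integrable lborel (\<lambda>y. of_real ((b \<bullet> y)\<^sup>2) * complex_of_real (bump 1 ((norm y)\<^sup>2)))"
      by (rule radial_integrable[OF derivative_sequence_bump bump_vanish]) (auto intro!: continuous_intros)
    then show ?thesis using bump_integrable[of 0, where 'a = "real^'d"] by (simp add: bump_mass_def)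
  qed
  finally show ?thesis by (simp add: eq_neg_iff_add_eq_0 field_simps)
qed

text \<open>By the mean value property \<open>u\<close> is its own convolution with a kernel of
  profile \<open>bump 1\<close>, so the derivative falls on the kernel, turning
  \<open>bump 1\<close> into \<open>bump 2\<close> and producing the factor 2 (z - x) \<bullet> b /
  r^2. The explicit formula later shows that \<open>h\<close> is locally constant. The condition on
  \<open>r\<close> and \<rho> keeps all balls of radius \<open>r\<close> about points of the small
  ball inside the large one.\<close>

lemma harmonic_has_derivative:
  fixes x\<^sub>0 :: "real^'d"
  assumes weak: "weak_laplacian (ball x\<^sub>0 R) u w" and w: "\<And>z. z \<in> ball x\<^sub>0 R \<Longrightarrow> w z = 0"
    and r: "0 < r" "r + \<rho> \<le> R"
  obtains D :: "real^'d \<Rightarrow> (real^'d) \<Rightarrow>\<^sub>L complex" where "continuous_on (ball x\<^sub>0 \<rho>) D"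
    "\<And>x. x \<in> ball x\<^sub>0 \<rho> \<Longrightarrow> (u has_derivative D x) (at x)"
    "\<And>x b. x \<in> ball x\<^sub>0 \<rho> \<Longrightarrow>
      D x b = of_real (- 2 / (r\<^sup>2 * bump_mass TYPE('d) 1)) * radial_mean (bump 2) (\<lambda>z. u z * of_real ((z - x) \<bullet> b)) x r"
proof -
  have u: "continuous_on UNIV u" using weak by (simp add: weak_laplacian_def)
  let ?m = "bump_mass TYPE('d) 1"
  have m: "?m \<noteq> 0" using bump_mass_1_neg[where 'd = 'd] by simp
  \<comment> \<open>Scaling to radius \<open>r\<close> contributes r^(-d), and division by the mass
    normalises the kernel.\<close>
  define C where "C = inverse r ^ CARD('d) / ?m"
  define k :: "real^'d \<Rightarrow> real" where "k z = C * bump 1 (1 / r\<^sup>2 * (norm z)\<^sup>2)" for z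
  define k' :: "real^'d \<Rightarrow> (real^'d) \<Rightarrow>\<^sub>L real" where "k' z = C *\<^sub>R radial_blinfun 1 (1 / r\<^sup>2) z" for z
  have k: "(k has_derivative k' z) (at z)" for z
    unfolding k_def[abs_def]
    by (rule has_derivative_eq_rhs[OF has_derivative_mult_right[OF radial_blinfun_has_derivative]])
      (auto simp: k'_def blinfun.bilinear_simps)
  have k': "continuous_on UNIV k'"
    unfolding k'_def by (intro continuous_intros radial_blinfun_continuous_on)
  have zero: "k z = 0" "k' z = 0" if "norm z \<ge> r" for z
  proof -
    have "r\<^sup>2 \<le> (norm z)\<^sup>2" using that r by (intro power_mono) auto
    then have "bump n (1 / r\<^sup>2 * (norm z)\<^sup>2) = 0" for n
      using r by (intro bump_eq_0) (simp add: divide_simps)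
    then show "k z = 0" "k' z = 0" by (simp_all add: k_def k'_def radial_blinfun_def)
  qed
  obtain D where D: "continuous_on (ball x\<^sub>0 \<rho>) D"
    "\<And>x. x \<in> ball x\<^sub>0 \<rho> \<Longrightarrow> ((\<lambda>x. LINT z|lborel. u z * of_real (k (z - x))) has_derivative blinfun_apply (D x)) (at x)"
    "\<And>x b. x \<in> ball x\<^sub>0 \<rho> \<Longrightarrow> D x b = - (LINT z|lborel. u z * of_real (k' (z - x) b))"
  proof (rule convolution_has_derivative[of u k k' r x\<^sub>0 \<rho>], goal_cases)
    case (6 D)
    show ?case by (rule that; fact 6)
  qed (use u k k' zero in auto)
  have conv: "(LINT z|lborel. u z * of_real (k (z - x))) = u x" if "x \<in> ball x\<^sub>0 \<rho>" for x
  proof -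
    have sub: "ball x (R - dist x\<^sub>0 x) \<subseteq> ball x\<^sub>0 R"
    proof
      fix z assume "z \<in> ball x (R - dist x\<^sub>0 x)"
      then show "z \<in> ball x\<^sub>0 R" using dist_triangle[of x\<^sub>0 z x] by simp
    qed
    have "radial_mean (bump 1) u x r = u x * of_real ?m"
      unfolding bump_mass_def
      by (rule radial_mean_harmonic[OF derivative_sequence_bump bump_vanish weak_laplacian_mono[OF weak sub]])
        (use w sub r that in auto)
    moreover have "radial_mean (bump 1) u x r = of_real ?m * (LINT z|lborel. u z * of_real (k (z - x)))"
      unfolding radial_mean_rescale[OF derivative_sequence_bump bump_vanish u r(1)]
        integral_mult_right_zero[symmetric]
      by (intro Bochner_Integration.integral_cong) (use m in \<open>simp_all add: k_def C_def\<close>)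
    ultimately show ?thesis using m by simp
  qed
  show thesis
  proof
    show "continuous_on (ball x\<^sub>0 \<rho>) D" by fact
    fix x assume x: "x \<in> ball x\<^sub>0 \<rho>"
    show "(u has_derivative D x) (at x)"
      by (rule has_derivative_transform_within_open[OF D(2)[OF x] _ x]) (simp_all add: conv)
    fix b
    have cont: "continuous_on UNIV (\<lambda>z. u z * of_real ((z - x) \<bullet> b))"
      by (intro continuous_intros u)
    have "D x b = - (LINT z|lborel. of_real (2 / (r\<^sup>2 * ?m)) * (of_real (inverse r ^ CARD('d)) * (u z * of_real ((z - x) \<bullet> b) * of_real (bump 2 (1 / r\<^sup>2 * (norm (z - x))\<^sup>2)))))"
      unfolding D(3)[OF x]
      by (intro arg_cong[where f = uminus] Bochner_Integration.integral_cong)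
        (simp_all add: k'_def radial_blinfun_apply blinfun.bilinear_simps C_def numeral_2_eq_2 mult_ac)
    also have "\<dots> = of_real (- 2 / (r\<^sup>2 * ?m)) * radial_mean (bump 2) (\<lambda>z. u z * of_real ((z - x) \<bullet> b)) x r"
      unfolding radial_mean_rescale[OF derivative_sequence_bump bump_vanish cont r(1)] integral_mult_right_zero
      by simp
    finally show "D x b = of_real (- 2 / (r\<^sup>2 * ?m)) * radial_mean (bump 2) (\<lambda>z. u z * of_real ((z - x) \<bullet> b)) x r" .
  qed
qed

subsection \<open>Local rigidity\<close>

text \<open>With z = x + r y and p = t(z)/r the error is (h(z) - h(x)) p^2 + h(x) (p - b \<bullet>
  y) (p + b \<bullet> y). Continuity of \<open>h\<close> controls the first term and
  differentiability of \<open>t\<close> at its zero the second, uniformly for |y| \<le> 1.\<close>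

lemma square_expansion:
  fixes h :: "'a::real_inner \<Rightarrow> complex" and t :: "'a \<Rightarrow> real"
  assumes "R > 0" and u: "\<And>z. z \<in> ball x R \<Longrightarrow> u z = h z * of_real ((t z)\<^sup>2)"
    and h: "isCont h x" and t: "(t has_derivative (\<lambda>v. b \<bullet> v)) (at x)" "t x = 0" and "e > 0"
  shows "\<exists>d>0. \<forall>r y. 0 < r \<longrightarrow> r < d \<longrightarrow> norm y \<le> 1 \<longrightarrow>
    norm (u (x + r *\<^sub>R y) /\<^sub>R r\<^sup>2 - h x * of_real ((b \<bullet> y)\<^sup>2)) \<le> e"
proof -
  \<comment> \<open>The two coefficients of \<open>e'\<close> in the final estimate, plus 1 for
    positivity.\<close>
  define C where "C = (norm b + 1)\<^sup>2 + norm (h x) * (2 * norm b + 1) + 1"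
  have C: "C > 0" by (simp add: C_def add_nonneg_pos)
  define e' where "e' = min 1 (e / C)"
  have e': "e' > 0" "e' \<le> 1" "e' * C \<le> e"
    using C \<open>e > 0\<close> by (auto simp: e'_def min_def field_simps)
  obtain d1 where d1: "d1 > 0" "\<And>z. norm (z - x) < d1 \<Longrightarrow> norm (t z - t x - b \<bullet> (z - x)) \<le> e' * norm (z - x)"
    using t(1) e'(1) unfolding has_derivative_at_alt by blast
  obtain d2 where d2: "d2 > 0" "\<And>z. dist z x < d2 \<Longrightarrow> dist (h z) (h x) < e'"
    using h e'(1) unfolding continuous_at_eps_delta by blast
  have "norm (u (x + r *\<^sub>R y) /\<^sub>R r\<^sup>2 - h x * of_real ((b \<bullet> y)\<^sup>2)) \<le> e"
    if r: "0 < r" "r < min R (min d1 d2)" and y: "norm y \<le> 1" for r y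
  proof -
    define z where "z = x + r *\<^sub>R y"
    have "norm (z - x) \<le> r" using r(1) y by (simp add: z_def mult_left_le)
    then have z: "norm (z - x) < d1" "dist z x < d2" "z \<in> ball x R"
      using r by (auto simp: dist_norm norm_minus_commute)
    define p where "p = t z / r"
    have "t z - t x - b \<bullet> (z - x) = (p - b \<bullet> y) * r"
      using r(1) t(2) by (simp add: p_def z_def field_simps)
    then have "\<bar>p - b \<bullet> y\<bar> * r = \<bar>t z - t x - b \<bullet> (z - x)\<bar>"
      using r(1) by (simp only: abs_mult abs_of_pos)
    also have "\<dots> \<le> e' * norm (z - x)" using d1(2)[OF z(1)] by simp
    also have "\<dots> \<le> e' * r" using \<open>norm (z - x) \<le> r\<close> e'(1) by simp
    finally have p: "\<bar>p - b \<bullet> y\<bar> \<le> e'" using r(1) by simp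
    have cs: "\<bar>b \<bullet> y\<bar> \<le> norm b"
      using Cauchy_Schwarz_ineq2[of b y] mult_left_mono[OF y, of "norm b"] by simp
    have p1: "\<bar>p\<bar> \<le> norm b + 1" and p2: "\<bar>p + b \<bullet> y\<bar> \<le> 2 * norm b + 1"
      using p cs e'(2) by linarith+
    have "p\<^sup>2 \<le> (norm b + 1)\<^sup>2" using power_mono[OF p1, of 2] by simp
    have "u z /\<^sub>R r\<^sup>2 = h z * of_real (p\<^sup>2)"
      using u[OF z(3)] by (simp add: p_def scaleR_conv_of_real power_mult_distrib power_inverse divide_inverse mult_ac)
    then have "u z /\<^sub>R r\<^sup>2 - h x * of_real ((b \<bullet> y)\<^sup>2) =
        (h z - h x) * of_real (p\<^sup>2) + h x * of_real ((p - b \<bullet> y) * (p + b \<bullet> y))"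
      by (simp add: algebra_simps power2_eq_square)
    also have "norm \<dots> \<le> norm ((h z - h x) * of_real (p\<^sup>2)) + norm (h x * of_real ((p - b \<bullet> y) * (p + b \<bullet> y)))"
      by (rule norm_triangle_ineq)
    also have "\<dots> = norm (h z - h x) * p\<^sup>2 + norm (h x) * (\<bar>p - b \<bullet> y\<bar> * \<bar>p + b \<bullet> y\<bar>)"
      by (simp only: norm_mult norm_of_real abs_mult abs_power2)
    also have "\<dots> \<le> e' * (norm b + 1)\<^sup>2 + norm (h x) * (e' * (2 * norm b + 1))"
      using d2(2)[OF z(2)] \<open>p\<^sup>2 \<le> _\<close> p p2 e'(1)
      by (intro add_mono mult_mono mult_left_mono) (auto simp: dist_norm)
    also have "\<dots> \<le> e' * C" using e'(1) by (simp add: C_def algebra_simps)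
    finally show ?thesis using e'(3) by (simp add: z_def)
  qed
  then show ?thesis using \<open>R > 0\<close> d1(1) d2(1) by (intro exI[of _ "min R (min d1 d2)"]) auto
qed

text \<open>The rescaled means of \<open>u\<close> have two expressions for their limit: -(1/4) 2 s
  h(x) m from the weak Laplacian, and -(|b|^2 / 2) h(x) m from the expansion of t^2 and the second
  moment, where m is the mass of \<open>bump 0\<close>. The factor h(x) m cancels.\<close>

lemma gradient_norm:
  fixes x :: "real^'d"
  assumes weak: "weak_laplacian (ball x R) u w" and "R > 0"
    and u: "\<And>z. z \<in> ball x R \<Longrightarrow> u z = h z * of_real ((t z)\<^sup>2)"
    and w: "\<And>z. z \<in> ball x R \<Longrightarrow> w z = h z * of_real (2 * s)"
    and h: "isCont h x" "h x \<noteq> 0" and t: "(t has_derivative (\<lambda>v. b \<bullet> v)) (at x)" "t x = 0"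
  shows "(norm b)\<^sup>2 = s"
proof -
  let ?m = "bump_mass TYPE('d) 0"
  have cu: "continuous_on UNIV u" using weak by (simp add: weak_laplacian_def)
  have x: "x \<in> ball x R" using \<open>R > 0\<close> by simp
  have M0: "radial_mean (bump 1) u x 0 = 0"
    using u[OF x] t(2) by (simp add: radial_mean_0[OF derivative_sequence_bump bump_vanish])
  have W0: "radial_mean (bump 0) w x 0 = h x * of_real (2 * s * ?m)"
    using w[OF x] by (simp add: radial_mean_0[OF derivative_sequence_bump bump_vanish] bump_mass_def)
  have 1: "((\<lambda>r. radial_mean (bump 1) u x r /\<^sub>R r\<^sup>2) \<longlongrightarrow> (- 1 / 4) *\<^sub>R (h x * of_real (2 * s * ?m))) (at_right 0)"
    using radial_mean_second_order[OF derivative_sequence_bump bump_vanish weak \<open>R > 0\<close>]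
    unfolding M0 W0 by simp
  have 2: "((\<lambda>r. radial_mean (bump 1) u x r /\<^sub>R r\<^sup>2) \<longlongrightarrow>
      (LINT y|lborel. h x * of_real ((b \<bullet> y)\<^sup>2) * of_real (bump 1 ((norm y)\<^sup>2)))) (at_right 0)"
  proof (rule radial_mean_quadratic_limit[OF derivative_sequence_bump bump_vanish cu])
    show "continuous_on UNIV (\<lambda>y. h x * of_real ((b \<bullet> y)\<^sup>2))" by (intro continuous_intros)
    show "\<exists>d>0. \<forall>r y. 0 < r \<longrightarrow> r < d \<longrightarrow> norm y \<le> 1 \<longrightarrow>
        norm (u (x + r *\<^sub>R y) /\<^sub>R r\<^sup>2 - h x * of_real ((b \<bullet> y)\<^sup>2)) \<le> e" if "e > 0" for e
      by (rule square_expansion[OF \<open>R > 0\<close> u h(1) t that])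
  qed
  have "(LINT y|lborel. h x * of_real ((b \<bullet> y)\<^sup>2) * of_real (bump 1 ((norm y)\<^sup>2))) =
      h x * (LINT y|lborel. of_real ((b \<bullet> y)\<^sup>2) * of_real (bump 1 ((norm y)\<^sup>2)))"
    unfolding integral_mult_right_zero[symmetric] by (simp only: mult.assoc)
  also have "\<dots> = h x * of_real (- ((norm b)\<^sup>2 / 2) * ?m)"
    by (simp only: bump_second_moment)
  also have "(LINT y|lborel. h x * of_real ((b \<bullet> y)\<^sup>2) * of_real (bump 1 ((norm y)\<^sup>2))) =
      (- 1 / 4) *\<^sub>R (h x * of_real (2 * s * ?m))"
    using tendsto_unique[OF _ 2 1] by simp
  finally have "h x * of_real ((- 1 / 4) * (2 * s * ?m)) = h x * of_real (- ((norm b)\<^sup>2 / 2) * ?m)"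
    by (simp add: scaleR_conv_of_real mult.left_commute)
  then have "(- 1 / 4) * (2 * s * ?m) = - ((norm b)\<^sup>2 / 2) * ?m"
    using h(2) by (simp only: mult_cancel_left of_real_eq_iff) simp
  then show ?thesis using bump_mass_0_pos[where 'd = 'd] by simp
qed

text \<open>The test functions give access to the scalar functions a \<bullet> \<tau>, whose
  gradients are values of the adjoint of the derivative. An isometric adjoint is surjective and has
  \<open>f\<close> as its inverse.\<close>

lemma orthogonal_transformation_adjointD:
  fixes f :: "'a::euclidean_space \<Rightarrow> 'a"
  assumes "linear f" "\<And>a. norm (adjoint f a) = norm a"
  shows "orthogonal_transformation f"
proof -
  have adj: "orthogonal_transformation (adjoint f)"
    using assms adjoint_linear by (auto simp: orthogonal_transformation)
  have inv: "f (adjoint f a) = a" for a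
  proof -
    have "f (adjoint f a) \<bullet> c = a \<bullet> c" for c
      using adjoint_works[OF assms(1)] adj by (metis orthogonal_transformation_def)
    then show ?thesis using vector_eq_rdot by blast
  qed
  have "norm (f v) = norm v" for v
  proof -
    obtain a where "v = adjoint f a" using orthogonal_transformation_surj[OF adj] by (metis surjD)
    then show ?thesis using inv assms(2) by simp
  qed
  then show ?thesis using assms(1) by (simp add: orthogonal_transformation)
qed

text \<open>Orthogonal derivatives make both \<tau> and its local inverse 1-Lipschitz on balls; the
  two inequalities combine to equality.\<close>

lemma local_isometry:
  fixes \<tau> :: "'a::euclidean_space \<Rightarrow> 'a" and T :: "'a \<Rightarrow> 'a \<Rightarrow>\<^sub>L 'a"
  assumes "R > 0" and \<tau>: "\<And>x. x \<in> ball x\<^sub>0 R \<Longrightarrow> (\<tau> has_derivative T x) (at x)"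
    and T: "continuous_on (ball x\<^sub>0 R) T" "\<And>x. x \<in> ball x\<^sub>0 R \<Longrightarrow> orthogonal_transformation (T x)"
  obtains \<rho> where "0 < \<rho>" "\<rho> \<le> R"
    "\<And>x y. x \<in> ball x\<^sub>0 \<rho> \<Longrightarrow> y \<in> ball x\<^sub>0 \<rho> \<Longrightarrow> norm (\<tau> x - \<tau> y) = norm (x - y)"
proof -
  have x0: "x\<^sub>0 \<in> ball x\<^sub>0 R" using \<open>R > 0\<close> by simp
  have lip: "norm (\<tau> x - \<tau> y) \<le> norm (x - y)" if "x \<in> ball x\<^sub>0 R" "y \<in> ball x\<^sub>0 R" for x y
  proof -
    have "norm (\<tau> x - \<tau> y) \<le> 1 * norm (x - y)"
    proof (rule differentiable_bound[OF convex_ball _ _ that])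
      fix x assume x: "x \<in> ball x\<^sub>0 R"
      show "(\<tau> has_derivative T x) (at x within ball x\<^sub>0 R)"
        using \<tau>[OF x] by (rule has_derivative_at_withinI)
      show "onorm (T x) \<le> 1"
        using T(2)[OF x] by (intro onorm_le) (simp add: orthogonal_transformation_norm)
    qed
    then show ?thesis by simp
  qed
  have bl: "bounded_linear (inv (T x\<^sub>0))"
    using orthogonal_transformation_inv[OF T(2)[OF x0]] orthogonal_transformation_linear
    by (intro linear_conv_bounded_linear[THEN iffD1]) blast
  have "Blinfun (inv (T x\<^sub>0)) o\<^sub>L T x\<^sub>0 = id_blinfun"
    by (rule blinfun_eqI)
      (simp add: bounded_linear_Blinfun_apply[OF bl] inv_f_f orthogonal_transformation_inj[OF T(2)[OF x0]])
  from inverse_function_theorem[OF open_ball \<tau> T(1) x0 this]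
  obtain U V g g' where U: "open U" "U \<subseteq> ball x\<^sub>0 R" "x\<^sub>0 \<in> U" and V: "open V" "\<tau> x\<^sub>0 \<in> V"
    and hom: "homeomorphism U V \<tau> g"
    and g: "\<And>y. y \<in> V \<Longrightarrow> (g has_derivative (g' y)) (at y)" "\<And>y. y \<in> V \<Longrightarrow> g' y = inv (T (g y))"
    by metis
  obtain r1 where r1: "r1 > 0" "ball x\<^sub>0 r1 \<subseteq> U" using U openE by metis
  obtain r2 where r2: "r2 > 0" "ball (\<tau> x\<^sub>0) r2 \<subseteq> V" using V openE by metis
  have glip: "norm (g x - g y) \<le> 1 * norm (x - y)" if "x \<in> ball (\<tau> x\<^sub>0) r2" "y \<in> ball (\<tau> x\<^sub>0) r2" for x y
  proof (rule differentiable_bound[OF convex_ball _ _ that])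
    fix x assume "x \<in> ball (\<tau> x\<^sub>0) r2"
    then have x: "x \<in> V" using r2 by blast
    then have "g x \<in> ball x\<^sub>0 R" using hom U(2) unfolding homeomorphism_def by blast
    then have "orthogonal_transformation (g' x)"
      using g(2)[OF x] T(2) orthogonal_transformation_inv by metis
    then show "onorm (g' x) \<le> 1" by (intro onorm_le) (simp add: orthogonal_transformation_norm)
    show "(g has_derivative g' x) (at x within ball (\<tau> x\<^sub>0) r2)"
      using g(1)[OF x] by (rule has_derivative_at_withinI)
  qed
  \<comment> \<open>\<open>r1\<close> keeps points where \<open>g\<close> inverts \<tau>; as \<tau>
    is 1-Lipschitz, \<open>r2\<close> keeps their images where \<open>g\<close> is
    1-Lipschitz.\<close>
  define \<rho> where "\<rho> = min R (min r1 r2)"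
  show thesis
  proof
    show "0 < \<rho>" "\<rho> \<le> R" using \<open>R > 0\<close> r1 r2 by (auto simp: \<rho>_def)
    fix x y assume xy: "x \<in> ball x\<^sub>0 \<rho>" "y \<in> ball x\<^sub>0 \<rho>"
    have sub: "z \<in> ball x\<^sub>0 R \<and> g (\<tau> z) = z \<and> \<tau> z \<in> ball (\<tau> x\<^sub>0) r2" if "z \<in> ball x\<^sub>0 \<rho>" for z
    proof (intro conjI)
      show zR: "z \<in> ball x\<^sub>0 R" using that by (simp add: \<rho>_def)
      have "z \<in> U" using that r1 by (auto simp: \<rho>_def)
      then show "g (\<tau> z) = z" using hom by (simp add: homeomorphism_def)
      show "\<tau> z \<in> ball (\<tau> x\<^sub>0) r2"
        using lip[OF x0 zR] that by (simp add: \<rho>_def dist_norm)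
    qed
    show "norm (\<tau> x - \<tau> y) = norm (x - y)"
      using glip[of "\<tau> x" "\<tau> y"] lip[of x y] sub[OF xy(1)] sub[OF xy(2)] by auto
  qed
qed

text \<open>Polarisation turns preserved distances into preserved inner products. Differentiating
  these in the second point at \<open>x\<^sub>0\<close> gives inner products with
  \<open>A v\<close>, and surjectivity of \<open>A\<close> determines the vector.\<close>

lemma isometry_ball_affine:
  fixes \<tau> :: "'a::euclidean_space \<Rightarrow> 'a"
  assumes "\<rho> > 0" and iso: "\<And>x y. x \<in> ball x\<^sub>0 \<rho> \<Longrightarrow> y \<in> ball x\<^sub>0 \<rho> \<Longrightarrow> norm (\<tau> x - \<tau> y) = norm (x - y)"
    and A: "(\<tau> has_derivative A) (at x\<^sub>0)" "orthogonal_transformation A" and x: "x \<in> ball x\<^sub>0 \<rho>"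
  shows "\<tau> x = \<tau> x\<^sub>0 + A (x - x\<^sub>0)"
proof -
  have x0: "x\<^sub>0 \<in> ball x\<^sub>0 \<rho>" using \<open>\<rho> > 0\<close> by simp
  have inner: "(\<tau> x - \<tau> x\<^sub>0) \<bullet> (\<tau> y - \<tau> x\<^sub>0) = (x - x\<^sub>0) \<bullet> (y - x\<^sub>0)" if y: "y \<in> ball x\<^sub>0 \<rho>" for y
    using iso[OF x x0] iso[OF y x0] iso[OF x y] by (simp add: dot_norm_neg)
  have "((\<lambda>y. (\<tau> x - \<tau> x\<^sub>0) \<bullet> (\<tau> y - \<tau> x\<^sub>0)) has_derivative (\<lambda>v. (\<tau> x - \<tau> x\<^sub>0) \<bullet> A v)) (at x\<^sub>0)"
    by (auto intro!: derivative_eq_intros A(1))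
  moreover have "((\<lambda>y. (\<tau> x - \<tau> x\<^sub>0) \<bullet> (\<tau> y - \<tau> x\<^sub>0)) has_derivative (\<lambda>v. (x - x\<^sub>0) \<bullet> v)) (at x\<^sub>0)"
  proof (rule has_derivative_transform_within_open[OF _ open_ball x0 inner[symmetric]])
    show "((\<lambda>y. (x - x\<^sub>0) \<bullet> (y - x\<^sub>0)) has_derivative (\<lambda>v. (x - x\<^sub>0) \<bullet> v)) (at x\<^sub>0)"
      by (auto intro!: derivative_eq_intros)
  qed
  ultimately have eq: "(\<tau> x - \<tau> x\<^sub>0) \<bullet> A v = (x - x\<^sub>0) \<bullet> v" for v
    using has_derivative_unique by metis
  have "(\<tau> x - \<tau> x\<^sub>0) \<bullet> w = A (x - x\<^sub>0) \<bullet> w" for w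
  proof -
    obtain v where "w = A v" using orthogonal_transformation_surj[OF A(2)] by (metis surjD)
    then show ?thesis using eq[of v] A(2) by (simp add: orthogonal_transformation_def)
  qed
  then have "\<tau> x - \<tau> x\<^sub>0 = A (x - x\<^sub>0)" using vector_eq_rdot by blast
  then show ?thesis by (simp add: algebra_simps)
qed

text \<open>
  Differentiability of \<open>\<tau>\<close> comes from \<open>\<tau> \<bullet> i = Re ((h (\<tau> \<bullet> i)) / h)\<close>, a quotient of harmonic functions.
\<close>

lemma differentiable_quotient_components:
  fixes h :: "'a::euclidean_space \<Rightarrow> complex" and \<tau> :: "'a \<Rightarrow> 'a"
    and Dh :: "'a \<Rightarrow> 'a \<Rightarrow>\<^sub>L complex" and Dv :: "'a \<Rightarrow> 'a \<Rightarrow> 'a \<Rightarrow>\<^sub>L complex"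
  assumes "open S" and nz: "\<And>x. x \<in> S \<Longrightarrow> h x \<noteq> 0"
    and h: "\<And>x. x \<in> S \<Longrightarrow> (h has_derivative Dh x) (at x)" "continuous_on S Dh"
    and v: "\<And>i x. i \<in> Basis \<Longrightarrow> x \<in> S \<Longrightarrow> ((\<lambda>x. h x * of_real (\<tau> x \<bullet> i)) has_derivative Dv i x) (at x)"
      "\<And>i. i \<in> Basis \<Longrightarrow> continuous_on S (Dv i)"
  obtains T :: "'a \<Rightarrow> 'a \<Rightarrow>\<^sub>L 'a" where "continuous_on S T"
    "\<And>x. x \<in> S \<Longrightarrow> (\<tau> has_derivative T x) (at x)"
proof -
  define w where "w i x = h x * of_real (\<tau> x \<bullet> i)" for i x
  define t where "t i x b = Re ((blinfun_apply (Dv i x) b * h x - w i x * blinfun_apply (Dh x) b) / (h x * h x))" for i x b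
  define F where "F x b = (\<Sum>i\<in>Basis. t i x b *\<^sub>R i)" for x b
  have F: "(\<tau> has_derivative F x) (at x)" if x: "x \<in> S" for x
    unfolding has_derivative_componentwise_within[of \<tau>]
  proof
    fix i :: 'a assume i: "i \<in> Basis"
    have "((\<lambda>x. Re (w i x / h x)) has_derivative t i x) (at x)"
      unfolding t_def w_def by (intro has_derivative_Re has_derivative_divide' v h i x nz)
    then have "((\<lambda>x. \<tau> x \<bullet> i) has_derivative t i x) (at x)"
      by (rule has_derivative_transform_within_open[OF _ \<open>open S\<close> x]) (simp add: w_def nz)
    then show "((\<lambda>x. \<tau> x \<bullet> i) has_derivative (\<lambda>b. F x b \<bullet> i)) (at x)"
      using i by (simp add: F_def inner_sum_left_Basis)
  qed
  define T where "T x = Blinfun (F x)" for x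
  have T: "blinfun_apply (T x) = F x" if "x \<in> S" for x
    unfolding T_def using F[OF that] by (intro bounded_linear_Blinfun_apply has_derivative_bounded_linear)
  have ch: "continuous_on S h"
    using h(1) has_derivative_continuous by (blast intro: continuous_at_imp_continuous_on)
  have cw: "continuous_on S (w i)" if "i \<in> Basis" for i
    unfolding w_def using v(1)[OF that] has_derivative_continuous
    by (blast intro: continuous_at_imp_continuous_on)
  have "continuous_on S T"
    unfolding continuous_on_eq_continuous_within
  proof (intro ballI continuous_blinfun_componentwiseI1)
    fix x b assume x: "x \<in> S"
    have "continuous_on S (\<lambda>x. F x b)"
      unfolding F_def t_def
      by (intro continuous_intros ch cw h(2) v(2)) (auto simp: nz)
    then have "continuous_on S (\<lambda>x. T x b)" by (simp add: T cong: continuous_on_cong)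
    then show "continuous (at x within S) (\<lambda>x. T x b)"
      using x by (simp add: continuous_on_eq_continuous_within)
  qed
  then show thesis using that F T by simp
qed

text \<open>\<open>u\<close> and \<open>w\<close> are existential because
  \<open>weak_laplacian\<close> asks for globally continuous functions, while \<open>h\<close> and
  \<tau> are under control only on the ball. The choice a = 0, c = -1 in \<open>lin\<close> covers
  \<open>h\<close> itself.\<close>

proposition local_rigidity:
  fixes h :: "real^'d \<Rightarrow> complex" and \<tau> :: "real^'d \<Rightarrow> real^'d"
  assumes "R > 0" and nz: "\<And>x. x \<in> ball x\<^sub>0 R \<Longrightarrow> h x \<noteq> 0"
    and lin: "\<And>a c. \<exists>u w. weak_laplacian (ball x\<^sub>0 R) u w \<and>
      (\<forall>z\<in>ball x\<^sub>0 R. u z = h z * of_real (a \<bullet> \<tau> z - c) \<and> w z = 0)"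
    and sq: "\<And>a c. \<exists>u w. weak_laplacian (ball x\<^sub>0 R) u w \<and>
      (\<forall>z\<in>ball x\<^sub>0 R. u z = h z * of_real ((a \<bullet> \<tau> z - c)\<^sup>2) \<and> w z = h z * of_real (2 * (norm a)\<^sup>2))"
  obtains \<rho> A where "0 < \<rho>" "orthogonal_transformation A"
    "\<And>x. x \<in> ball x\<^sub>0 \<rho> \<Longrightarrow> \<tau> x = \<tau> x\<^sub>0 + A (x - x\<^sub>0)" "\<And>x. x \<in> ball x\<^sub>0 \<rho> \<Longrightarrow> h x = h x\<^sub>0"
proof -
  \<comment> \<open>Half the radius leaves room for means over balls of radius R/2 about every point
    of \<open>S\<close>.\<close>
  define S where "S = ball x\<^sub>0 (R / 2)"
  have S: "open S" "x\<^sub>0 \<in> S" "S \<subseteq> ball x\<^sub>0 R" using \<open>R > 0\<close> by (auto simp: S_def)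
  have sub: "ball x (R / 2) \<subseteq> ball x\<^sub>0 R" if "x \<in> S" for x
  proof
    fix z assume "z \<in> ball x (R / 2)"
    then show "z \<in> ball x\<^sub>0 R" using that dist_triangle[of x\<^sub>0 z x] by (simp add: S_def)
  qed
  define P where "P a c D \<longleftrightarrow> continuous_on S D \<and>
      (\<forall>x\<in>S. ((\<lambda>z. h z * of_real (a \<bullet> \<tau> z - c)) has_derivative blinfun_apply (D x)) (at x))"
    for a c and D :: "real^'d \<Rightarrow> (real^'d) \<Rightarrow>\<^sub>L complex"
  have "\<exists>D. P a c D" for a c
  proof -
    obtain u w where uw: "weak_laplacian (ball x\<^sub>0 R) u w" "\<And>z. z \<in> ball x\<^sub>0 R \<Longrightarrow> u z = h z * of_real (a \<bullet> \<tau> z - c)"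
        "\<And>z. z \<in> ball x\<^sub>0 R \<Longrightarrow> w z = 0"
      using lin by metis
    have "R / 2 > 0" "R / 2 + R / 2 \<le> R" using \<open>R > 0\<close> by auto
    from harmonic_has_derivative[OF uw(1,3) this]
    obtain D where D: "continuous_on S D" "\<And>x. x \<in> S \<Longrightarrow> (u has_derivative blinfun_apply (D x)) (at x)"
      unfolding S_def by metis
    have "((\<lambda>z. h z * of_real (a \<bullet> \<tau> z - c)) has_derivative blinfun_apply (D x)) (at x)" if "x \<in> S" for x
      by (rule has_derivative_transform_within_open[OF D(2)[OF that] S(1) that]) (use uw(2) S(3) in blast)
    then show ?thesis using D(1) unfolding P_def by blast
  qed
  then obtain D where "\<And>a c. P a c (D a c)" by metis
  then have D: "\<And>a c. continuous_on S (D a c)"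
      "\<And>a c x. x \<in> S \<Longrightarrow> ((\<lambda>z. h z * of_real (a \<bullet> \<tau> z - c)) has_derivative blinfun_apply (D a c x)) (at x)"
    by (auto simp: P_def)
  have dh: "(h has_derivative D 0 (- 1) x) (at x)" if "x \<in> S" for x
    using D(2)[OF that, of 0 "- 1"] by simp
  have dv: "((\<lambda>z. h z * of_real (\<tau> z \<bullet> i)) has_derivative D i 0 x) (at x)" if "x \<in> S" for x i
    using D(2)[OF that, of i 0] by (simp add: inner_commute)
  obtain T where T: "continuous_on S T" "\<And>x. x \<in> S \<Longrightarrow> (\<tau> has_derivative blinfun_apply (T x)) (at x)"
  proof (rule differentiable_quotient_components[where S = S and h = h and Dh = "D 0 (- 1)" and \<tau> = \<tau>
        and Dv = "\<lambda>i. D i 0"], goal_cases)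
    case (7 T)
    show ?case by (rule that; fact 7)
  qed (use S nz dh dv D(1) in auto)
  have orth: "orthogonal_transformation (T x)" if x: "x \<in> S" for x
  proof (rule orthogonal_transformation_adjointD)
    show lin_T: "linear (T x)"
      using T(2)[OF x] has_derivative_linear by blast
    fix a
    \<comment> \<open>The shift c = a \<bullet> \<tau>(x) makes the function vanish to second order
      at \<open>x\<close>, so derivatives of \<open>h\<close> do not enter.\<close>
    obtain u w where uw: "weak_laplacian (ball x\<^sub>0 R) u w"
        "\<And>z. z \<in> ball x\<^sub>0 R \<Longrightarrow> u z = h z * of_real ((a \<bullet> \<tau> z - a \<bullet> \<tau> x)\<^sup>2)"
        "\<And>z. z \<in> ball x\<^sub>0 R \<Longrightarrow> w z = h z * of_real (2 * (norm a)\<^sup>2)"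
      using sq by metis
    have "(norm (adjoint (T x) a))\<^sup>2 = (norm a)\<^sup>2"
    proof (rule gradient_norm[OF weak_laplacian_mono[OF uw(1) sub[OF x]]])
      show "((\<lambda>z. a \<bullet> \<tau> z - a \<bullet> \<tau> x) has_derivative (\<lambda>v. adjoint (T x) a \<bullet> v)) (at x)"
        by (rule has_derivative_eq_rhs[OF has_derivative_diff[OF has_derivative_inner_right[OF T(2)[OF x]] has_derivative_const]])
          (simp add: fun_eq_iff inner_commute adjoint_works[OF lin_T])
      show "isCont h x" using dh[OF x] has_derivative_continuous by blast
      show "h x \<noteq> 0" using nz S(3) x by blast
    qed (use uw(2,3) sub[OF x] \<open>R > 0\<close> in auto)
    then show "norm (adjoint (T x) a) = norm a" by simp
  qed
  obtain \<rho> where \<rho>: "0 < \<rho>" "\<rho> \<le> R / 2"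
      "\<And>x y. x \<in> ball x\<^sub>0 \<rho> \<Longrightarrow> y \<in> ball x\<^sub>0 \<rho> \<Longrightarrow> norm (\<tau> x - \<tau> y) = norm (x - y)"
  proof (rule local_isometry[of "R / 2" x\<^sub>0 \<tau> T], goal_cases)
    case (5 \<rho>)
    show ?case by (rule that; fact 5)
  qed (use T orth \<open>R > 0\<close> in \<open>auto simp: S_def\<close>)
  define A where "A = blinfun_apply (T x\<^sub>0)"
  have A: "orthogonal_transformation A" unfolding A_def by (rule orth[OF S(2)])
  have aff: "\<tau> x = \<tau> x\<^sub>0 + A (x - x\<^sub>0)" if "x \<in> ball x\<^sub>0 \<rho>" for x
    using isometry_ball_affine[OF \<rho>(1,3) _ A that] T(2)[OF S(2)] by (simp add: A_def)
  have sub\<rho>: "ball x\<^sub>0 \<rho> \<subseteq> ball x\<^sub>0 R" using \<rho> by auto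
  obtain u w where uw: "weak_laplacian (ball x\<^sub>0 R) u w" "\<And>z. z \<in> ball x\<^sub>0 R \<Longrightarrow> u z = h z"
      "\<And>z. z \<in> ball x\<^sub>0 R \<Longrightarrow> w z = 0"
    using lin[of 0 "- 1"] by auto
  have weak: "weak_laplacian (ball x\<^sub>0 \<rho>) u w" "\<And>z. z \<in> ball x\<^sub>0 \<rho> \<Longrightarrow> w z = 0"
    using weak_laplacian_mono[OF uw(1) sub\<rho>] uw(3) sub\<rho> by auto
  define r where "r = \<rho> / 2"
  have r: "0 < r" "r + r \<le> \<rho>" using \<rho>(1) by (auto simp: r_def)
  obtain E where E: "\<And>x. x \<in> ball x\<^sub>0 r \<Longrightarrow> (u has_derivative blinfun_apply (E x)) (at x)"
    "\<And>x b. x \<in> ball x\<^sub>0 r \<Longrightarrow> blinfun_apply (E x) b =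
      of_real (- 2 / (r\<^sup>2 * bump_mass TYPE('d) 1)) * radial_mean (bump 2) (\<lambda>z. u z * of_real ((z - x) \<bullet> b)) x r"
  proof (rule harmonic_has_derivative[OF weak(1) _ r], goal_cases)
    case (2 E)
    show ?case by (rule that; fact 2)
  qed (rule weak(2))
  have E0: "blinfun_apply (E x) b = 0" if x: "x \<in> ball x\<^sub>0 r" for x b
  proof -
    \<comment> \<open>For a = A b, orthogonality gives A b \<bullet> (\<tau>(z) - \<tau>(x)) = b
      \<bullet> (z - x), so the function averaged in the formula for \<open>E\<close> is weakly
      harmonic and vanishes at its centre.\<close>
    obtain u' w' where uw': "weak_laplacian (ball x\<^sub>0 R) u' w'"
        "\<And>z. z \<in> ball x\<^sub>0 R \<Longrightarrow> u' z = h z * of_real (A b \<bullet> \<tau> z - A b \<bullet> \<tau> x)"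
        "\<And>z. z \<in> ball x\<^sub>0 R \<Longrightarrow> w' z = 0"
      using lin by metis
    have sub': "ball x (\<rho> - dist x\<^sub>0 x) \<subseteq> ball x\<^sub>0 \<rho>"
    proof
      fix z assume "z \<in> ball x (\<rho> - dist x\<^sub>0 x)"
      then show "z \<in> ball x\<^sub>0 \<rho>" using dist_triangle[of x\<^sub>0 z x] by simp
    qed
    have x': "x \<in> ball x\<^sub>0 \<rho>" "r < \<rho> - dist x\<^sub>0 x" using x r by auto
    have u': "u' z = u z * of_real ((z - x) \<bullet> b)" if z: "z \<in> ball x\<^sub>0 \<rho>" for z
    proof -
      have "\<tau> z - \<tau> x = A (z - x)"
        using aff[OF z] aff[OF x'(1)] linear_diff[OF orthogonal_transformation_linear[OF A], symmetric]
        by simp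
      then have eq: "A b \<bullet> \<tau> z - A b \<bullet> \<tau> x = (z - x) \<bullet> b"
        using A by (simp add: orthogonal_transformation_def inner_commute flip: inner_diff_right)
      have zR: "z \<in> ball x\<^sub>0 R" using z sub\<rho> by blast
      show ?thesis unfolding uw'(2)[OF zR] uw(2)[OF zR] eq ..
    qed
    have "radial_mean (bump 2) (\<lambda>z. u z * of_real ((z - x) \<bullet> b)) x r = radial_mean (bump 2) u' x r"
      unfolding radial_mean_def
    proof (rule Bochner_Integration.integral_cong[OF refl])
      fix y
      show "u (x + r *\<^sub>R y) * of_real ((x + r *\<^sub>R y - x) \<bullet> b) * of_real (bump 2 ((norm y)\<^sup>2)) =
          u' (x + r *\<^sub>R y) * of_real (bump 2 ((norm y)\<^sup>2))"
      proof (cases "norm y < 1")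
        case True
        then have "norm (r *\<^sub>R y) \<le> r" using r(1) by (simp add: mult_left_le)
        then have "x + r *\<^sub>R y \<in> ball x (\<rho> - dist x\<^sub>0 x)" using x'(2) by (simp add: dist_norm)
        then show ?thesis using u' sub' by auto
      qed (simp add: bump_norm_0)
    qed
    also have "\<dots> = 0"
    proof -
      have 1: "weak_laplacian (ball x (\<rho> - dist x\<^sub>0 x)) u' w'"
        using weak_laplacian_mono[OF uw'(1)] sub' sub\<rho> by blast
      have 2: "w' z = 0" if "z \<in> ball x (\<rho> - dist x\<^sub>0 x)" for z
        using uw'(3) that sub' sub\<rho> by blast
      have 3: "\<forall>n. \<forall>t\<ge>1. bump (Suc n) t = 0" by (simp add: bump_eq_0)
      have "radial_mean (bump (Suc 1)) u' x r =
          u' x * of_real (LINT y|(lborel :: (real^'d) measure). bump (Suc 1) ((norm y)\<^sup>2))"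
        by (rule radial_mean_harmonic[where G = "\<lambda>n. bump (Suc n)",
              OF derivative_sequence_shift[OF derivative_sequence_bump] 3 1 2])
          (use r(1) x'(2) in auto)
      then show ?thesis using u'[OF x'(1)] by (simp add: numeral_2_eq_2)
    qed
    finally show ?thesis using E(2)[OF x] by simp
  qed
  have "\<exists>k. \<forall>x\<in>ball x\<^sub>0 r. u x = k"
  proof (rule has_derivative_zero_constant[OF convex_ball])
    fix x assume x: "x \<in> ball x\<^sub>0 r"
    have "blinfun_apply (E x) = (\<lambda>b. 0)" by (intro ext E0 x)
    from has_derivative_eq_rhs[OF E(1)[OF x] this]
    show "(u has_derivative (\<lambda>b. 0)) (at x within ball x\<^sub>0 r)" by (rule has_derivative_at_withinI)
  qed
  then obtain k where k: "\<And>x. x \<in> ball x\<^sub>0 r \<Longrightarrow> u x = k" by blast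
  show thesis
  proof (rule that[OF r(1) A])
    fix x assume x: "x \<in> ball x\<^sub>0 r"
    show "\<tau> x = \<tau> x\<^sub>0 + A (x - x\<^sub>0)" using x r by (intro aff) auto
    have "x \<in> ball x\<^sub>0 R" "x\<^sub>0 \<in> ball x\<^sub>0 R" "x\<^sub>0 \<in> ball x\<^sub>0 r" using x r \<rho> \<open>R > 0\<close> by auto
    then show "h x = h x\<^sub>0" using uw(2)[of x] uw(2)[of x\<^sub>0] k[of x] k[of x\<^sub>0] x by simp
  qed
qed

subsection \<open>Operators commuting with the Laplacian\<close>

text \<open>\<open>frechet_derivative\<close> chooses among the derivatives at the point. Functions
  agreeing nearby have the same derivatives, so the choices coincide, even where there are
  none.\<close>

lemma partial_derivative_cong_open:
  assumes "open N" "x \<in> N" "\<And>z. z \<in> N \<Longrightarrow> f z = g z"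
  shows "partial_derivative i f x = partial_derivative i g x"
proof -
  have "(f has_derivative D) (at x) \<longleftrightarrow> (g has_derivative D) (at x)" for D
    using has_derivative_transform_within_open[OF _ assms(1,2)] assms(3) by metis
  then show ?thesis by (simp add: partial_derivative_def frechet_derivative_def)
qed

lemma laplacian_cong_open:
  assumes N: "open N" "x \<in> N" and eq: "\<And>z. z \<in> N \<Longrightarrow> f z = g z"
  shows "laplacian f x = laplacian g x"
  unfolding laplacian_def
  by (intro sum.cong refl partial_derivative_cong_open[OF N] partial_derivative_cong_open[OF N(1)] eq)

lemma laplacian_affine:
  "laplacian (\<lambda>z::real^'d. of_real (a \<bullet> z - c)) x = 0"
proof -
  have "((\<lambda>z::real^'d. complex_of_real (a \<bullet> z - c)) has_derivative (\<lambda>h. of_real (a \<bullet> h))) (at x)" for x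
    by (auto intro!: derivative_eq_intros)
  from partial_derivative_eqI[OF this]
  have 1: "partial_derivative i (\<lambda>z::real^'d. complex_of_real (a \<bullet> z - c)) = (\<lambda>x. of_real (a $ i))" for i
    by (auto simp: inner_axis)
  have 2: "partial_derivative i (\<lambda>x::real^'d. complex_of_real (a $ i)) x = 0" for i
    by (rule partial_derivative_eqI[OF has_derivative_const])
  show ?thesis unfolding laplacian_def 1 2 by simp
qed

lemma laplacian_square:
  "laplacian (\<lambda>z::real^'d. of_real ((a \<bullet> z - c)\<^sup>2)) x = of_real (2 * (norm a)\<^sup>2)"
proof -
  have "((\<lambda>z::real^'d. complex_of_real ((a \<bullet> z - c)\<^sup>2)) has_derivative
      (\<lambda>h. of_real (2 * (a \<bullet> h) * (a \<bullet> x - c)))) (at x)" for x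
    by (rule has_derivative_of_real) (auto intro!: derivative_eq_intros)
  from partial_derivative_eqI[OF this]
  have 1: "partial_derivative i (\<lambda>z::real^'d. complex_of_real ((a \<bullet> z - c)\<^sup>2)) =
      (\<lambda>x. of_real (2 * a $ i * (a \<bullet> x - c)))" for i
    by (simp add: inner_axis fun_eq_iff)
  have 2: "partial_derivative i (\<lambda>x::real^'d. complex_of_real (2 * a $ i * (a \<bullet> x - c))) x = of_real (2 * (a $ i)\<^sup>2)" for i
  proof -
    have "((\<lambda>x::real^'d. complex_of_real (2 * a $ i * (a \<bullet> x - c))) has_derivative
        (\<lambda>h. of_real (2 * a $ i * (a \<bullet> h)))) (at x)"
      by (rule has_derivative_of_real) (auto intro!: derivative_eq_intros)
    note eq = partial_derivative_eqI[OF this]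
    show ?thesis by (rule trans[OF eq]) (simp add: inner_axis power2_eq_square)
  qed
  have "(\<Sum>i\<in>UNIV. (a $ i)\<^sup>2) = (norm a)\<^sup>2"
    unfolding power2_norm_eq_inner inner_vec_def by (simp add: power2_eq_square)
  then show ?thesis
    unfolding laplacian_def 1 2 of_real_sum[symmetric] sum_distrib_left[symmetric] by simp
qed

section \<open>Pointwise and local form of the operator\<close>

lemma cutoff_in_Cc_infinity:
  fixes y :: "real^'d"
  assumes "open \<Omega>" "y \<in> \<Omega>"
  obtains \<eta> \<delta> where "\<eta> \<in> Cc_infinity \<Omega>" "0 < \<delta>" "\<And>x. x \<in> ball y \<delta> \<Longrightarrow> \<eta> x = 1"
proof -
  obtain \<rho> where \<rho>: "\<rho> > 0" "cball y \<rho> \<subseteq> \<Omega>" using assms open_contains_cball by blast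
  obtain \<eta> \<delta> where \<eta>: "smooth \<eta>" "0 < \<delta>" "\<And>x. x \<in> ball y \<delta> \<Longrightarrow> \<eta> x = (1::complex)"
      "\<And>x. x \<notin> cball y \<rho> \<Longrightarrow> \<eta> x = 0"
    using cutoff_exists[OF \<rho>(1), of y] by metis
  then show thesis using that[of \<eta> \<delta>] \<rho> Cc_infinityI[of \<eta> "cball y \<rho>" \<Omega>] by auto
qed

lemma point_representation:
  fixes U :: "(real^'d \<Rightarrow> complex) \<Rightarrow> real^'d \<Rightarrow> complex"
  assumes "open \<Omega>\<^sub>1" and U: "bounded_linear_C0 \<Omega>\<^sub>1 \<Omega>\<^sub>2 U"
    and disj: "\<And>f g. f \<in> C0 \<Omega>\<^sub>1 \<Longrightarrow> g \<in> C0 \<Omega>\<^sub>1 \<Longrightarrow> \<forall>x. f x * g x = 0 \<Longrightarrow> \<forall>x. U f x * U g x = 0"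
    and nz: "\<exists>f\<in>C0 \<Omega>\<^sub>1. U f x \<noteq> 0"
  shows "\<exists>y c. y \<in> \<Omega>\<^sub>1 \<and> c \<noteq> 0 \<and> (\<forall>f\<in>C0 \<Omega>\<^sub>1. U f x = c * f y)"
proof -
  obtain K where K: "\<And>f. f \<in> C0 \<Omega>\<^sub>1 \<Longrightarrow> sup_norm (U f) \<le> K * sup_norm f"
    using U unfolding bounded_linear_C0_def by blast
  have le: "norm (f x) \<le> sup_norm f" if "f \<in> C0 \<Omega>" for f :: "real^'d \<Rightarrow> complex" and x \<Omega>
  proof -
    have "bounded (range f)" using C0D_bcontfun[OF that] by (simp add: bcontfun_def)
    then have "bdd_above (range (\<lambda>x. norm (f x)))"
      by (auto simp: bounded_iff bdd_above_def)
    then show ?thesis unfolding sup_norm_def by (rule cSUP_upper[rotated]) simp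
  qed
  have bound: "norm (U f x) \<le> \<bar>K\<bar> * B" if f: "f \<in> C0 \<Omega>\<^sub>1" and B: "\<And>x. norm (f x) \<le> B" for f B
  proof -
    have "U f \<in> C0 \<Omega>\<^sub>2" using U f by (auto simp: bounded_linear_C0_def)
    then have "norm (U f x) \<le> K * sup_norm f" using le K[OF f] order_trans by blast
    also have "\<dots> \<le> \<bar>K\<bar> * sup_norm f"
      using order_trans[OF norm_ge_zero le[OF f]] by (intro mult_right_mono) auto
    also have "\<dots> \<le> \<bar>K\<bar> * B"
      unfolding sup_norm_def using B by (intro mult_left_mono cSUP_least) auto
    finally show ?thesis .
  qed
  show ?thesis
  proof (rule disjointness_preserving_functional[OF \<open>open \<Omega>\<^sub>1\<close>, of "\<lambda>f. U f x" "\<bar>K\<bar>"], goal_cases)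
    case (1 f g)
    then show ?case using U by (simp add: bounded_linear_C0_def)
  next
    case (2 f c)
    then show ?case using U by (simp add: bounded_linear_C0_def)
  next
    case (3 f B)
    then show ?case by (rule bound)
  next
    case (4 f g)
    then show ?case using disj by blast
  next
    case 5
    then show ?case by (rule nz)
  next
    case (6 y c)
    then show ?case by blast
  qed
qed

text \<open>Continuity of \<tau> is replaced by a second cutoff \<eta>' concentrated near
  \<open>\<tau> x\<^sub>0\<close>: wherever the continuous function \<open>U \<eta>'\<close> is
  nonzero, \<tau> stays in the support of \<eta>'. This also yields a ball inside
  \<open>W\<close>.\<close>

lemma local_structure:
  fixes U :: "(real^'d \<Rightarrow> complex) \<Rightarrow> real^'d \<Rightarrow> complex"
  assumes "open \<Omega>\<^sub>1" and U: "\<And>f. f \<in> C0 \<Omega>\<^sub>1 \<Longrightarrow> U f \<in> C0 \<Omega>\<^sub>2"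
    and lap: "\<And>f \<phi>. f \<in> Cc_infinity \<Omega>\<^sub>1 \<Longrightarrow> \<phi> \<in> Cc_infinity \<Omega>\<^sub>2 \<Longrightarrow>
      regular_distribution \<Omega>\<^sub>2 (U (laplacian f)) \<phi> = distribution_laplacian (regular_distribution \<Omega>\<^sub>2 (U f)) \<phi>"
    and W: "W = {x. \<exists>f\<in>C0 \<Omega>\<^sub>1. U f x \<noteq> 0}"
    and \<tau>: "\<And>x. x \<in> W \<Longrightarrow> \<tau> x \<in> \<Omega>\<^sub>1" and h: "\<And>x. x \<in> W \<Longrightarrow> h x \<noteq> 0"
    and rep: "\<And>x f. x \<in> W \<Longrightarrow> f \<in> C0 \<Omega>\<^sub>1 \<Longrightarrow> U f x = h x * f (\<tau> x)"
    and x0: "x\<^sub>0 \<in> W"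
  shows "\<exists>\<rho>>0. \<exists>A. orthogonal_transformation A \<and> ball x\<^sub>0 \<rho> \<subseteq> W \<and>
    (\<forall>x\<in>ball x\<^sub>0 \<rho>. \<tau> x = \<tau> x\<^sub>0 + A (x - x\<^sub>0) \<and> h x = h x\<^sub>0)"
proof -
  obtain \<eta> \<delta> where \<eta>: "\<eta> \<in> Cc_infinity \<Omega>\<^sub>1" "0 < \<delta>" "\<And>x. x \<in> ball (\<tau> x\<^sub>0) \<delta> \<Longrightarrow> \<eta> x = 1"
    using cutoff_in_Cc_infinity[OF \<open>open \<Omega>\<^sub>1\<close> \<tau>[OF x0]] by metis
  obtain \<rho> where \<rho>: "\<rho> > 0" "cball (\<tau> x\<^sub>0) \<rho> \<subseteq> \<Omega>\<^sub>1"
    using \<open>open \<Omega>\<^sub>1\<close> \<tau>[OF x0] open_contains_cball by blast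
  \<comment> \<open>The support of \<eta>' has to lie inside \<open>\<Omega>\<^sub>1\<close> and
    inside the ball on which \<eta> is 1.\<close>
  have "0 < min (\<delta> / 2) \<rho>" using \<eta>(2) \<rho> by simp
  then obtain \<eta>' \<delta>' where \<eta>': "smooth \<eta>'" "0 < \<delta>'" "\<And>x. x \<in> ball (\<tau> x\<^sub>0) \<delta>' \<Longrightarrow> \<eta>' x = (1::complex)"
      "\<And>x. x \<notin> cball (\<tau> x\<^sub>0) (min (\<delta> / 2) \<rho>) \<Longrightarrow> \<eta>' x = 0"
    using cutoff_exists[of "min (\<delta> / 2) \<rho>" "\<tau> x\<^sub>0"] by metis
  have \<eta>'C: "\<eta>' \<in> C0 \<Omega>\<^sub>1"
    using \<eta>' \<rho>(2) by (intro Cc_infinity_C0 Cc_infinityI[of _ "cball (\<tau> x\<^sub>0) (min (\<delta> / 2) \<rho>)"]) auto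
  have "open {x. U \<eta>' x \<noteq> 0}"
    by (intro open_Collect_neq C0_continuous_on[OF U[OF \<eta>'C]] continuous_intros)
  moreover have "U \<eta>' x\<^sub>0 \<noteq> 0" using rep[OF x0 \<eta>'C] h[OF x0] \<eta>'(2,3) by simp
  ultimately obtain R where R: "R > 0" "ball x\<^sub>0 R \<subseteq> {x. U \<eta>' x \<noteq> 0}"
    by (metis (mono_tags) mem_Collect_eq open_contains_ball)
  have BW: "ball x\<^sub>0 R \<subseteq> W" using R \<eta>'C W by blast
  have near: "\<tau> x \<in> ball (\<tau> x\<^sub>0) \<delta>" if "x \<in> ball x\<^sub>0 R" for x
  proof -
    have "x \<in> W" "U \<eta>' x \<noteq> 0" using that R(2) BW by blast+
    then have "\<eta>' (\<tau> x) \<noteq> 0" using rep[OF _ \<eta>'C, of x] by auto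
    then have "\<tau> x \<in> cball (\<tau> x\<^sub>0) (min (\<delta> / 2) \<rho>)" using \<eta>'(4) by blast
    then show ?thesis using \<eta>(2) by simp
  qed
  have "W \<subseteq> \<Omega>\<^sub>2" using C0_eq_0[OF U] W by blast
  then have B2: "ball x\<^sub>0 R \<subseteq> \<Omega>\<^sub>2" using BW by blast
  have full: "(LINT z:\<Omega>\<^sub>2|lborel. g z * \<phi> z) = (LINT z|lborel. g z * \<phi> z)"
    if "\<phi> \<in> Cc_infinity \<Omega>\<^sub>2" for g \<phi> :: "real^'d \<Rightarrow> complex"
    unfolding set_lebesgue_integral_def using C0_eq_0[OF Cc_infinity_C0[OF that]]
    by (intro Bochner_Integration.integral_cong) (auto simp: indicator_def)
  \<comment> \<open>\<open>P\<close> lacks compact support, but \<open>\<eta> * P\<close> agrees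
    with it near every \<tau>(z), and the representation sees the function and its Laplacian only
    there.\<close>
  have weak: "\<exists>u w. weak_laplacian (ball x\<^sub>0 R) u w \<and>
      (\<forall>z\<in>ball x\<^sub>0 R. u z = h z * P (\<tau> z) \<and> w z = h z * laplacian P (\<tau> z))" if P: "smooth P" for P
  proof -
    define f where "f z = \<eta> z * P z" for z
    have f: "f \<in> Cc_infinity \<Omega>\<^sub>1" unfolding f_def by (rule Cc_infinity_mult_smooth[OF \<eta>(1) P])
    note lf = laplacian_Cc_infinity[OF f]
    have eq: "f z = P z" if "z \<in> ball (\<tau> x\<^sub>0) \<delta>" for z using \<eta>(3)[OF that] by (simp add: f_def)
    have "weak_laplacian (ball x\<^sub>0 R) (U f) (U (laplacian f))"
      unfolding weak_laplacian_def
    proof (intro conjI ballI)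
      show "continuous_on UNIV (U f)" "continuous_on UNIV (U (laplacian f))"
        using f lf by (auto intro: C0_continuous_on U Cc_infinity_C0)
      fix \<phi> assume "\<phi> \<in> Cc_infinity (ball x\<^sub>0 R)"
      then have \<phi>: "\<phi> \<in> Cc_infinity \<Omega>\<^sub>2" using Cc_infinity_mono[OF B2] by blast
      show "(LINT z|lborel. U f z * laplacian \<phi> z) = (LINT z|lborel. U (laplacian f) z * \<phi> z)"
        using lap[OF f \<phi>]
        unfolding regular_distribution_def distribution_laplacian_def
        by (simp only: full[OF \<phi>] full[OF laplacian_Cc_infinity[OF \<phi>]])
    qed
    moreover have "U f z = h z * P (\<tau> z) \<and> U (laplacian f) z = h z * laplacian P (\<tau> z)"
      if z: "z \<in> ball x\<^sub>0 R" for z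
    proof -
      have zW: "z \<in> W" using z BW by blast
      have "laplacian f (\<tau> z) = laplacian P (\<tau> z)"
        by (rule laplacian_cong_open[OF open_ball near[OF z] eq])
      then show ?thesis
        using rep[OF zW Cc_infinity_C0[OF f]] rep[OF zW Cc_infinity_C0[OF lf]] eq[OF near[OF z]] by simp
    qed
    ultimately show ?thesis by blast
  qed
  have aff: "smooth (\<lambda>z::real^'d. of_real (a \<bullet> z - c))" for a c
    using smooth_diff[OF smooth_inner smooth_const[of "of_real c"]] by simp
  have sq: "smooth (\<lambda>z::real^'d. of_real ((a \<bullet> z - c)\<^sup>2))" for a c
    using smooth_mult[OF aff[of a c] aff[of a c]] by (simp add: power2_eq_square)
  show ?thesis
  proof (rule local_rigidity[OF R(1), of x\<^sub>0 h \<tau>], goal_cases)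
    case (1 x)
    then show ?case using h BW by blast
  next
    case (2 a c)
    show ?case using weak[OF aff[of a c]] by (simp only: laplacian_affine mult_zero_right)
  next
    case (3 a c)
    show ?case using weak[OF sq[of a c]] by (simp only: laplacian_square)
  next
    case (4 \<rho> A)
    have "ball x\<^sub>0 (min \<rho> R) \<subseteq> ball x\<^sub>0 \<rho>" "ball x\<^sub>0 (min \<rho> R) \<subseteq> W" "0 < min \<rho> R"
      using BW 4(1) R(1) by auto
    then show ?case using 4(2-4) by blast
  qed
qed

text \<open>Linear part, translation part and \<open>h\<close> are locally constant, hence so is the
  triple \<open>F\<close>. Recovering the linear part as the derivative of \<tau> makes it
  independent of the local choice of \<open>A\<close>.\<close>

lemma affine_on_connected:
  fixes \<tau> :: "'a::euclidean_space \<Rightarrow> 'a" and h :: "'a \<Rightarrow> complex"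
  assumes "connected C"
    and loc: "\<And>x. x \<in> C \<Longrightarrow> \<exists>\<rho>>0. \<exists>A. orthogonal_transformation A \<and>
      (\<forall>y\<in>ball x \<rho>. \<tau> y = \<tau> x + A (y - x) \<and> h y = h x)"
  obtains A b c where "orthogonal_transformation A" "\<And>x. x \<in> C \<Longrightarrow> \<tau> x = A x + b \<and> h x = c"
proof (cases "C = {}")
  case False
  then obtain p where p: "p \<in> C" by blast
  define D where "D x = frechet_derivative \<tau> (at x)" for x
  define F where "F x = (h x, D x, \<tau> x - D x x)" for x
  have const: "\<exists>\<rho>>0. orthogonal_transformation (D x) \<and> (\<forall>y\<in>ball x \<rho>. F x = F y)" if x: "x \<in> C" for x
  proof -
    obtain \<rho> A where A: "\<rho> > 0" "orthogonal_transformation A"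
        "\<And>y. y \<in> ball x \<rho> \<Longrightarrow> \<tau> y = \<tau> x + A (y - x)" "\<And>y. y \<in> ball x \<rho> \<Longrightarrow> h y = h x"
      using loc[OF x] by metis
    have lin: "linear A" by (rule orthogonal_transformation_linear[OF A(2)])
    have eq: "A (y - x) = A y - A x" for y by (rule linear_diff[OF lin])
    have bl: "bounded_linear A" using lin by (simp add: linear_conv_bounded_linear)
    have D: "D y = A" if y: "y \<in> ball x \<rho>" for y
    proof -
      have "((\<lambda>z. \<tau> x + A (z - x)) has_derivative A) (at y)"
        unfolding eq using bounded_linear_imp_has_derivative[OF bl]
        by (auto intro!: derivative_eq_intros)
      then have "(\<tau> has_derivative A) (at y)"
        by (rule has_derivative_transform_within_open[OF _ open_ball y]) (simp add: A(3))
      then show ?thesis unfolding D_def by (rule frechet_derivative_at[symmetric])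
    qed
    have "F y = (h x, A, \<tau> x - A x)" if y: "y \<in> ball x \<rho>" for y
      using A(3,4)[OF y] D[OF y] eq[of y] by (simp add: F_def)
    then show ?thesis using A(1,2) D[of x] by (metis centre_in_ball)
  qed
  have F: "F p = F x" if x: "x \<in> C" for x
  proof (rule connected_local_const[OF \<open>connected C\<close> p x], intro ballI)
    fix x assume "x \<in> C"
    then obtain \<rho> where "\<rho> > 0" "\<forall>y\<in>ball x \<rho>. F x = F y" using const by blast
    then show "\<forall>\<^sub>F y in at x within C. F x = F y"
      unfolding eventually_at by (intro exI[of _ \<rho>]) (auto simp: dist_commute)
  qed
  show thesis
  proof (rule that[of "D p" "\<tau> p - D p p" "h p"])
    show "orthogonal_transformation (D p)" using const[OF p] by blast
    fix x assume "x \<in> C"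
    then have "h p = h x" "D p = D x" "\<tau> p - D p p = \<tau> x - D x x"
      using F[of x] unfolding F_def by (metis Pair_inject)+
    then show "\<tau> x = D p x + (\<tau> p - D p p) \<and> h x = h p" by simp
  qed
qed (use that[OF orthogonal_transformation_id] in blast)

text \<open>
  The image is open and, because \<open>U f = c (f \<circ> \<tau>)\<close> persists on the closure of a component, also
  relatively closed in the connected set \<open>\<Omega>\<^sub>1\<close>.
\<close>

lemma component_image:
  fixes U :: "(real^'d \<Rightarrow> complex) \<Rightarrow> real^'d \<Rightarrow> complex"
  assumes "open \<Omega>\<^sub>1" "connected \<Omega>\<^sub>1" and U: "\<And>f. f \<in> C0 \<Omega>\<^sub>1 \<Longrightarrow> U f \<in> C0 \<Omega>\<^sub>2"
    and W: "W = {x. \<exists>f\<in>C0 \<Omega>\<^sub>1. U f x \<noteq> 0}" "open W" and C: "C \<in> components W"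
    and A: "orthogonal_transformation A" and "c \<noteq> 0" and sub: "(\<lambda>x. A x + b) ` C \<subseteq> \<Omega>\<^sub>1"
    and rep: "\<And>x f. x \<in> C \<Longrightarrow> f \<in> C0 \<Omega>\<^sub>1 \<Longrightarrow> U f x = c * f (A x + b)"
  shows "(\<lambda>x. A x + b) ` C = \<Omega>\<^sub>1"
proof -
  let ?\<tau> = "\<lambda>x. A x + b"
  have lin: "linear A" by (rule orthogonal_transformation_linear[OF A])
  have dist: "dist (?\<tau> x) (?\<tau> y) = dist x y" for x y
    using orthogonal_transformation_norm[OF A, of "x - y"] by (simp add: dist_norm linear_diff[OF lin])
  have "open (A ` C)"
    using open_components[OF W(2) C] lin orthogonal_transformation_surj[OF A]
    by (intro open_surjective_linear_image)
  from open_translation[OF this, of b] have op: "open (?\<tau> ` C)"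
    by (simp add: image_image add.commute)
  have "\<Omega>\<^sub>1 \<inter> closure (?\<tau> ` C) \<subseteq> ?\<tau> ` C"
  proof
    fix y assume y: "y \<in> \<Omega>\<^sub>1 \<inter> closure (?\<tau> ` C)"
    obtain x where x: "y = ?\<tau> x"
      using orthogonal_transformation_surj[OF A] by (metis surjD diff_add_cancel)
    have "x \<in> closure C"
      unfolding closure_approachable
    proof (intro allI impI)
      fix e :: real assume "e > 0"
      have "?\<tau> x \<in> closure (?\<tau> ` C)" using y x by blast
      then obtain z where "z \<in> C" "dist (?\<tau> z) (?\<tau> x) < e"
        using \<open>e > 0\<close> unfolding closure_approachable by blast
      then show "\<exists>z\<in>C. dist z x < e" unfolding dist by blast
    qed
    obtain \<eta> \<delta> where \<eta>: "\<eta> \<in> Cc_infinity \<Omega>\<^sub>1" "0 < \<delta>" "\<And>x. x \<in> ball y \<delta> \<Longrightarrow> \<eta> x = 1"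
      using cutoff_in_Cc_infinity[OF \<open>open \<Omega>\<^sub>1\<close>, of y] y by blast
    note \<eta>C = Cc_infinity_C0[OF \<eta>(1)]
    have "continuous_on UNIV A" using lin by (simp add: linear_continuous_on linear_conv_bounded_linear)
    then have "continuous_on UNIV (\<lambda>z. c * \<eta> (?\<tau> z))"
      by (intro continuous_intros continuous_on_compose2[OF C0_continuous_on[OF \<eta>C, of UNIV]]) auto
    \<comment> \<open>The formula for \<open>U \<eta>\<close> extends from \<open>C\<close> to its
      closure; since \<eta> is 1 at \<open>y\<close>, it gives the nonzero value \<open>c\<close> at
      \<open>x\<close>.\<close>
    then have "closed {z. U \<eta> z = c * \<eta> (?\<tau> z)}"
      by (intro closed_Collect_eq C0_continuous_on[OF U[OF \<eta>C]])
    moreover have "C \<subseteq> {z. U \<eta> z = c * \<eta> (?\<tau> z)}" using rep[OF _ \<eta>C] by blast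
    ultimately have "x \<in> {z. U \<eta> z = c * \<eta> (?\<tau> z)}"
      using closure_minimal \<open>x \<in> closure C\<close> by blast
    then have "U \<eta> x \<noteq> 0" using \<open>c \<noteq> 0\<close> \<eta>(2) \<eta>(3)[of y] by (simp add: x)
    then have "x \<in> W" using W(1) \<eta>C by blast
    \<comment> \<open>Adjoining a limit point keeps \<open>C\<close> connected, so maximality of the
      component puts \<open>x\<close> into \<open>C\<close>.\<close>
    have "insert x C \<subseteq> closure C" using \<open>x \<in> closure C\<close> closure_subset[of C] by simp
    then have conn: "connected (insert x C)"
      by (intro connected_intermediate_closure[OF in_components_connected[OF C]]) auto
    have "insert x C \<subseteq> W" using \<open>x \<in> W\<close> in_components_subset[OF C] by simp
    then have "insert x C \<subseteq> C"
      using in_components_nonempty[OF C] by (intro components_maximal[OF C conn]) auto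
    then show "y \<in> ?\<tau> ` C" using x by blast
  qed
  then have eq: "\<Omega>\<^sub>1 \<inter> closure (?\<tau> ` C) = ?\<tau> ` C"
    using sub closure_subset[of "?\<tau> ` C"] by (intro equalityI Int_greatest)
  have "closedin (top_of_set \<Omega>\<^sub>1) (?\<tau> ` C)"
    using closedin_closed_Int[OF closed_closure, of \<Omega>\<^sub>1 "?\<tau> ` C"] unfolding eq .
  moreover have "openin (top_of_set \<Omega>\<^sub>1) (?\<tau> ` C)"
    by (rule open_subset[OF sub op])
  ultimately have "?\<tau> ` C = {} \<or> ?\<tau> ` C = \<Omega>\<^sub>1"
    using \<open>connected \<Omega>\<^sub>1\<close>[unfolded connected_clopen, rule_format, of "?\<tau> ` C"] by simp
  then show ?thesis using in_components_nonempty[OF C] by simp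
qed

theorem theorem4p1:
  fixes \<Omega>\<^sub>1 \<Omega>\<^sub>2 :: "(real^'d) set"
    and U :: "(real^'d \<Rightarrow> complex) \<Rightarrow> real^'d \<Rightarrow> complex"
  assumes "open \<Omega>\<^sub>1" and "open \<Omega>\<^sub>2" and "connected \<Omega>\<^sub>1"
    and "bounded_linear_C0 \<Omega>\<^sub>1 \<Omega>\<^sub>2 U"
    and "\<exists>f\<in>C0 \<Omega>\<^sub>1. U f \<noteq> (\<lambda>x. 0)"
    and "\<And>f g. \<lbrakk>f \<in> C0 \<Omega>\<^sub>1; g \<in> C0 \<Omega>\<^sub>1; \<forall>x. f x * g x = 0\<rbrakk> \<Longrightarrow> \<forall>x. U f x * U g x = 0"
    and "\<And>f \<phi>. \<lbrakk>f \<in> Cc_infinity \<Omega>\<^sub>1; \<phi> \<in> Cc_infinity \<Omega>\<^sub>2\<rbrakk> \<Longrightarrow>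
           regular_distribution \<Omega>\<^sub>2 (U (laplacian f)) \<phi> =
           distribution_laplacian (regular_distribution \<Omega>\<^sub>2 (U f)) \<phi>"
  shows "\<exists>(I :: nat set) (\<omega> :: nat \<Rightarrow> (real^'d) set) (\<tau> :: nat \<Rightarrow> real^'d \<Rightarrow> real^'d) (c :: nat \<Rightarrow> complex).
           disjoint_family_on \<omega> I \<and>
           (\<forall>i\<in>I. open (\<omega> i) \<and> connected (\<omega> i) \<and> \<omega> i \<subseteq> \<Omega>\<^sub>2) \<and>
           (\<forall>i\<in>I. (\<forall>x y. dist (\<tau> i x) (\<tau> i y) = dist x y) \<and> \<tau> i ` \<omega> i = \<Omega>\<^sub>1) \<and>
           (\<exists>i\<in>I. c i \<noteq> 0) \<and>
           (\<forall>f\<in>C0 \<Omega>\<^sub>1.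
              (\<forall>i\<in>I. \<forall>x\<in>\<omega> i. U f x = c i * f (\<tau> i x)) \<and>
              (\<forall>x\<in>\<Omega>\<^sub>2 - (\<Union>i\<in>I. \<omega> i). U f x = 0))"
proof -
  define W where "W = {x. \<exists>f\<in>C0 \<Omega>\<^sub>1. U f x \<noteq> 0}"
  have U: "U f \<in> C0 \<Omega>\<^sub>2" if "f \<in> C0 \<Omega>\<^sub>1" for f
    using assms(4) that by (auto simp: bounded_linear_C0_def)
  define rep_at where "rep_at x y c \<longleftrightarrow> y \<in> \<Omega>\<^sub>1 \<and> c \<noteq> 0 \<and> (\<forall>f\<in>C0 \<Omega>\<^sub>1. U f x = c * f y)" for x y c
  have "\<exists>y c. rep_at x y c" if "x \<in> W" for x
    unfolding rep_at_def using that
    by (intro point_representation[OF assms(1,4,6)]) (auto simp: W_def)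
  then obtain \<tau> h where "\<And>x. x \<in> W \<Longrightarrow> rep_at x (\<tau> x) (h x)" by metis
  then have \<tau>: "\<And>x. x \<in> W \<Longrightarrow> \<tau> x \<in> \<Omega>\<^sub>1" and h: "\<And>x. x \<in> W \<Longrightarrow> h x \<noteq> 0"
    and rep: "\<And>x f. x \<in> W \<Longrightarrow> f \<in> C0 \<Omega>\<^sub>1 \<Longrightarrow> U f x = h x * f (\<tau> x)"
    by (auto simp: rep_at_def)
  have loc: "\<exists>\<rho>>0. \<exists>A. orthogonal_transformation A \<and> ball x \<rho> \<subseteq> W \<and>
      (\<forall>y\<in>ball x \<rho>. \<tau> y = \<tau> x + A (y - x) \<and> h y = h x)" if "x \<in> W" for x
    by (rule local_structure[OF assms(1) U assms(7) W_def \<tau> h rep that])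
  have "open W" unfolding open_contains_ball using loc by blast
  define piece where "piece C A b c \<longleftrightarrow> orthogonal_transformation A \<and> c \<noteq> 0 \<and> (\<lambda>x. A x + b) ` C = \<Omega>\<^sub>1 \<and>
      (\<forall>x\<in>C. \<forall>f\<in>C0 \<Omega>\<^sub>1. U f x = c * f (A x + b))" for C and A :: "real^'d \<Rightarrow> real^'d" and b c
  have "\<exists>A b c. piece C A b c" if C: "C \<in> components W" for C
  proof -
    have CW: "C \<subseteq> W" "C \<noteq> {}" using C in_components_subset in_components_nonempty by blast+
    obtain A b c where A: "orthogonal_transformation A" "\<And>x. x \<in> C \<Longrightarrow> \<tau> x = A x + b \<and> h x = c"
    proof (rule affine_on_connected[of C \<tau> h], goal_cases)
      case 1
      show ?case by (rule in_components_connected[OF C])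
    next
      case (2 x)
      then show ?case using loc CW(1) by blast
    next
      case (3 A b c)
      show ?case by (rule that; fact 3)
    qed
    have c: "c \<noteq> 0" using A(2) h CW by blast
    have repC: "U f x = c * f (A x + b)" if "x \<in> C" "f \<in> C0 \<Omega>\<^sub>1" for x f
      using rep[of x f] A(2)[OF that(1)] that CW by auto
    have "(\<lambda>x. A x + b) ` C = \<Omega>\<^sub>1"
    proof (rule component_image[OF assms(1,3) U W_def \<open>open W\<close> C A(1) c _ repC])
      show "(\<lambda>x. A x + b) ` C \<subseteq> \<Omega>\<^sub>1"
      proof (rule image_subsetI)
        fix x assume "x \<in> C"
        then have "A x + b = \<tau> x" "x \<in> W" using A(2)[of x] CW(1) by auto
        then show "A x + b \<in> \<Omega>\<^sub>1" using \<tau> by simp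
      qed
    qed
    then have "piece C A b c" using A(1) c repC by (auto simp: piece_def)
    then show ?thesis by blast
  qed
  then obtain A b c where piece: "\<And>C. C \<in> components W \<Longrightarrow> piece C (A C) (b C) (c C)" by metis
  have countable: "countable (components W)"
  proof (rule countable_disjoint_open_subsets)
    show "pairwise disjnt (components W)"
      using pairwise_disjoint_components[of W] unfolding pairwise_def disjnt_def .
  qed (rule open_components[OF \<open>open W\<close>])
  \<comment> \<open>Numbering by \<open>to_nat_on\<close> treats finite and infinite families of
    components alike.\<close>
  define I where "I = to_nat_on (components W) ` components W"
  define \<omega> where "\<omega> = from_nat_into (components W)"
  have \<omega>: "\<omega> i \<in> components W" "to_nat_on (components W) (\<omega> i) = i" if "i \<in> I" for i
    using that countable by (auto simp: I_def \<omega>_def)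
  have range: "\<exists>i\<in>I. \<omega> i = C" if "C \<in> components W" for C
    using that countable by (auto simp: I_def \<omega>_def intro!: bexI[of _ "to_nat_on (components W) C"])
  have Union: "(\<Union>i\<in>I. \<omega> i) = W"
  proof -
    have "(\<Union>i\<in>I. \<omega> i) = \<Union>(components W)" using \<omega>(1) range by blast
    then show ?thesis by simp
  qed
  have "W \<subseteq> \<Omega>\<^sub>2" using C0_eq_0[OF U] by (auto simp: W_def)
  define \<tau>' where "\<tau>' i x = A (\<omega> i) x + b (\<omega> i)" for i x
  have "disjoint_family_on \<omega> I"
    unfolding disjoint_family_on_def
  proof (intro ballI impI)
    fix i j assume ij: "i \<in> I" "j \<in> I" "i \<noteq> j"
    then have "\<omega> i \<noteq> \<omega> j" using \<omega>(2) by metis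
    then show "\<omega> i \<inter> \<omega> j = {}" using \<omega>(1) ij components_nonoverlap by metis
  qed
  moreover have "open (\<omega> i) \<and> connected (\<omega> i) \<and> \<omega> i \<subseteq> \<Omega>\<^sub>2" if "i \<in> I" for i
    using \<omega>(1)[OF that] \<open>open W\<close> \<open>W \<subseteq> \<Omega>\<^sub>2\<close> open_components in_components_connected in_components_subset
    by blast
  moreover have "(\<forall>x y. dist (\<tau>' i x) (\<tau>' i y) = dist x y) \<and> \<tau>' i ` \<omega> i = \<Omega>\<^sub>1" if "i \<in> I" for i
  proof -
    have A: "orthogonal_transformation (A (\<omega> i))" "(\<lambda>x. A (\<omega> i) x + b (\<omega> i)) ` \<omega> i = \<Omega>\<^sub>1"
      using piece[OF \<omega>(1)[OF that]] by (auto simp: piece_def)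
    have "dist (\<tau>' i x) (\<tau>' i y) = dist x y" for x y
      using orthogonal_transformation_norm[OF A(1), of "x - y"]
        linear_diff[OF orthogonal_transformation_linear[OF A(1)], of x y]
      by (simp add: \<tau>'_def dist_norm)
    then show ?thesis using A(2) by (simp add: \<tau>'_def[abs_def])
  qed
  \<comment> \<open>Each constant is nonzero by \<open>piece\<close>, so it suffices to find one
    component; there is one because \<open>U\<close> is nonzero.\<close>
  moreover have "\<exists>i\<in>I. c (\<omega> i) \<noteq> 0"
  proof -
    obtain f x where "f \<in> C0 \<Omega>\<^sub>1" "U f x \<noteq> 0" using assms(5) by (auto simp: fun_eq_iff)
    then have "x \<in> W" by (auto simp: W_def)
    then obtain i where "i \<in> I" using Union by blast
    then show ?thesis using piece[OF \<omega>(1)] by (auto simp: piece_def)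
  qed
  moreover have "U f x = c (\<omega> i) * f (\<tau>' i x)" if "f \<in> C0 \<Omega>\<^sub>1" "i \<in> I" "x \<in> \<omega> i" for f i x
    using piece[OF \<omega>(1)[OF that(2)]] that by (simp add: piece_def \<tau>'_def)
  moreover have "U f x = 0" if "f \<in> C0 \<Omega>\<^sub>1" "x \<in> \<Omega>\<^sub>2 - (\<Union>i\<in>I. \<omega> i)" for f x
    using that unfolding Union by (auto simp: W_def)
  ultimately show ?thesis
    by (intro exI[of _ I] exI[of _ \<omega>] exI[of _ \<tau>'] exI[of _ "\<lambda>i. c (\<omega> i)"] conjI ballI) auto
qed

end
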